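(* Let $\Bbbk$ be a commutative ring, $M$ a $\Bbbk$-module and $\Phi:M\times M\to\Bbbk$ a bilinear form with $\Phi(x,x)=0$ for all $x$ (not necessarily nondegenerate). If $M$ is flat over $\Bbbk$, then the canonical surjections $\phi^n:S^n(M)\to SW_n(M)/SW_{n-1}(M)$ are isomorphisms for all $n\ge0$, hence so is $\phi:S(M)\to\operatorname{gr}_F SW(M)$.
   Context: The symplectic Weyl algebra is $SW(M)=SW(M,\Phi):=T(M)/I_\Phi$, where $T(M)=\bigoplus_{n\ge0}M^{\otimes n}$ and $I_\Phi$ is the two-sided ideal generated by $x\otimes y-y\otimes x-\Phi(x,y)\cdot1$ for $x,y\in M$. Its filtration is $SW_n(M):=$ image of $\bigoplus_{m\le n}M^{\otimes m}$ (with $SW_{-1}=0$), and $\operatorname{gr}_F SW(M)=\bigoplus_n SW_n/SW_{n-1}$. The map $\phi^n$ sends $x_1\cdots x_n\in S^n(M)$ to the class of the product of the images of $x_1,\dots,x_n$ in $SW_n(M)$; it is well defined because these images commute modulo $SW_{n-1}(M)$. *)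

theory Defs
  imports Complex_Main "HOL-Library.Function_Algebras"
begin

definition fscale :: "'k::comm_ring_1 \<Rightarrow> ('a \<Rightarrow> 'k) \<Rightarrow> ('a \<Rightarrow> 'k)" where
  "fscale c f = (\<lambda>a. c * f a)"

definition delta :: "'a \<Rightarrow> ('a \<Rightarrow> 'k::zero_neq_one)" where
  "delta a = (\<lambda>b. if b = a then 1 else 0)"

abbreviation fspan :: "('a \<Rightarrow> 'k::comm_ring_1) set \<Rightarrow> ('a \<Rightarrow> 'k) set" where
  "fspan \<equiv> module.span fscale"

definition coset :: "'b::ab_group_add set \<Rightarrow> 'b \<Rightarrow> 'b set" where
  "coset S f = (\<lambda>s. f + s) ` S"

definition quot_set :: "'b::ab_group_add set \<Rightarrow> 'b set \<Rightarrow> 'b set set" where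
  "quot_set A S = coset S ` A"

definition bilinear_form :: "('k::comm_ring_1 \<Rightarrow> 'm::ab_group_add \<Rightarrow> 'm) \<Rightarrow> ('m \<Rightarrow> 'm \<Rightarrow> 'k) \<Rightarrow> bool" where
  "bilinear_form smul \<Phi> \<longleftrightarrow>
     (\<forall>x y z. \<Phi> (x + y) z = \<Phi> x z + \<Phi> y z) \<and>
     (\<forall>x y z. \<Phi> x (y + z) = \<Phi> x y + \<Phi> x z) \<and>
     (\<forall>c x y. \<Phi> (smul c x) y = c * \<Phi> x y) \<and>
     (\<forall>c x y. \<Phi> x (smul c y) = c * \<Phi> x y)"

text \<open>Concrete tensor product I \<otimes> M of an ideal I of k with M: free module on
  I \<times> M modulo the bilinearity relations.\<close>
definition tensor_free :: "'k::comm_ring_1 set \<Rightarrow> ('k \<times> 'm \<Rightarrow> 'k) set" where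
  "tensor_free I = fspan {delta (a, x) | a x. a \<in> I}"

definition tensor_rels :: "('k::comm_ring_1 \<Rightarrow> 'm::ab_group_add \<Rightarrow> 'm) \<Rightarrow> 'k set \<Rightarrow> ('k \<times> 'm \<Rightarrow> 'k) set" where
  "tensor_rels smul I = fspan (
      {delta (a + b, x) - delta (a, x) - delta (b, x) | a b x. a \<in> I \<and> b \<in> I}
    \<union> {delta (a, x + y) - delta (a, x) - delta (a, y) | a x y. a \<in> I}
    \<union> {delta (c * a, x) - fscale c (delta (a, x)) | c a x. a \<in> I}
    \<union> {delta (a, smul c x) - fscale c (delta (a, x)) | c a x. a \<in> I})"

definition tensor_mult :: "('k::comm_ring_1 \<Rightarrow> 'm::ab_group_add \<Rightarrow> 'm) \<Rightarrow> ('k \<times> 'm \<Rightarrow> 'k) \<Rightarrow> 'm" where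
  "tensor_mult smul f = (\<Sum>p\<in>{p. f p \<noteq> 0}. smul (f p) (smul (fst p) (snd p)))"

text \<open>Flatness via the ideal criterion: I \<otimes> M \<rightarrow> M injective for every ideal I.\<close>
definition flat_module :: "('k::comm_ring_1 \<Rightarrow> 'm::ab_group_add \<Rightarrow> 'm) \<Rightarrow> bool" where
  "flat_module smul \<longleftrightarrow>
     (\<forall>I::'k set. module.subspace (*) I \<longrightarrow>
        (\<forall>f \<in> tensor_free I. tensor_mult smul f = 0 \<longrightarrow> f \<in> tensor_rels smul I))"

text \<open>Everything lives in the free module on words ('m list \<Rightarrow> 'k, finitely supported).
  Multilinearity relations (for words of length in L); the free module on words of
  length n modulo these is M^{\<otimes>n}.\<close>
definition mult_rels :: "('k::comm_ring_1 \<Rightarrow> 'm::ab_group_add \<Rightarrow> 'm) \<Rightarrow> nat set \<Rightarrow> ('m list \<Rightarrow> 'k) set" where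
  "mult_rels smul L =
      {delta (u @ [x + y] @ v) - delta (u @ [x] @ v) - delta (u @ [y] @ v) | u x y v.
          length u + length v + 1 \<in> L}
    \<union> {delta (u @ [smul c x] @ v) - fscale c (delta (u @ [x] @ v)) | u c x v.
          length u + length v + 1 \<in> L}"

text \<open>Generators (multiplied on both sides by words) of I_\<Phi>.\<close>
definition weyl_rels :: "('m \<Rightarrow> 'm \<Rightarrow> 'k::comm_ring_1) \<Rightarrow> ('m list \<Rightarrow> 'k) set" where
  "weyl_rels \<Phi> = {delta (u @ [x, y] @ v) - delta (u @ [y, x] @ v) - fscale (\<Phi> x y) (delta (u @ v)) | u x y v. True}"

text \<open>Preimage of I_\<Phi> in the free algebra on M; SW(M) = free / weyl_ideal.\<close>
definition weyl_ideal :: "('k::comm_ring_1 \<Rightarrow> 'm::ab_group_add \<Rightarrow> 'm) \<Rightarrow> ('m \<Rightarrow> 'm \<Rightarrow> 'k) \<Rightarrow> ('m list \<Rightarrow> 'k) set" where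
  "weyl_ideal smul \<Phi> = fspan (mult_rels smul UNIV \<union> weyl_rels \<Phi>)"

text \<open>SW_le n = preimage of SW_{n-1}(M) in the free module (so SW_le 0 = weyl_ideal, i.e. SW_{-1} = 0).\<close>
definition SW_le :: "('k::comm_ring_1 \<Rightarrow> 'm::ab_group_add \<Rightarrow> 'm) \<Rightarrow> ('m \<Rightarrow> 'm \<Rightarrow> 'k) \<Rightarrow> nat \<Rightarrow> ('m list \<Rightarrow> 'k) set" where
  "SW_le smul \<Phi> n = fspan (weyl_ideal smul \<Phi> \<union> {delta w | w. length w < n})"

definition gr_SW :: "('k::comm_ring_1 \<Rightarrow> 'm::ab_group_add \<Rightarrow> 'm) \<Rightarrow> ('m \<Rightarrow> 'm \<Rightarrow> 'k) \<Rightarrow> nat \<Rightarrow> ('m list \<Rightarrow> 'k) set set" where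
  "gr_SW smul \<Phi> n = quot_set (SW_le smul \<Phi> (Suc n)) (SW_le smul \<Phi> n)"

definition sym_rels :: "nat set \<Rightarrow> ('m list \<Rightarrow> 'k::comm_ring_1) set" where
  "sym_rels L = {delta (u @ [x, y] @ v) - delta (u @ [y, x] @ v) | u x y v. length u + length v + 2 \<in> L}"

definition Sym_pow :: "('k::comm_ring_1 \<Rightarrow> 'm::ab_group_add \<Rightarrow> 'm) \<Rightarrow> nat \<Rightarrow> ('m list \<Rightarrow> 'k) set set" where
  "Sym_pow smul n = quot_set (fspan {delta w | w. length w = n}) (fspan (mult_rels smul {n} \<union> sym_rels {n}))"

text \<open>The canonical map \<phi>^n : S^n(M) \<rightarrow> SW_n/SW_{n-1}, x_1\<cdots>x_n \<mapsto> class of x_1\<cdots>x_n.\<close>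
definition phi_n :: "('k::comm_ring_1 \<Rightarrow> 'm::ab_group_add \<Rightarrow> 'm) \<Rightarrow> ('m \<Rightarrow> 'm \<Rightarrow> 'k) \<Rightarrow> nat \<Rightarrow> ('m list \<Rightarrow> 'k) set \<Rightarrow> ('m list \<Rightarrow> 'k) set" where
  "phi_n smul \<Phi> n C = (\<Union>f\<in>C. coset (SW_le smul \<Phi> n) f)"

end

theory Submission
  imports Defs
begin

text \<open>Suppose first that \<open>\<Phi> x y = B x y - B y x\<close> for a bilinear form \<open>B\<close>, and let \<open>D x\<close> be the
  derivation of the symmetric algebra with \<open>D x y = B x y\<close>. The derivations commute, so letting
  \<open>x\<close> act by multiplication by \<open>x\<close> plus \<open>D x\<close> makes the symmetric algebra a module over the Weyl
  algebra. A word of length \<open>n\<close> sends \<open>1\<close> to the same product in the symmetric algebra plus terms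
  of lower degree; hence a homogeneous element of degree \<open>n\<close> that vanishes in the graded quotient of
  the Weyl algebra already vanishes in the \<open>n\<close>-th symmetric power.

  A form \<open>B\<close> exists on every free module. If the module is flat, the finitely many linear
  relations that witness such a vanishing lift along a linear map from a finite free module (the
  equational criterion for flatness); there the pulled back form is of the above shape, and the
  conclusion is pushed forward again.\<close>

section \<open>Finitely supported functions and linear extension\<close>

interpretation fun_module: module "fscale :: 'k::comm_ring_1 \<Rightarrow> ('a \<Rightarrow> 'k) \<Rightarrow> ('a \<Rightarrow> 'k)"
  by unfold_locales (auto simp: fscale_def fun_eq_iff algebra_simps)

lemma sum_fun_apply: "(\<Sum>i\<in>A. f i) a = (\<Sum>i\<in>A. f i a)"
  for f :: "'i \<Rightarrow> 'a \<Rightarrow> 'b::comm_monoid_add"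
  by (induction A rule: infinite_finite_induct) auto

definition finsupp :: "('a \<Rightarrow> 'k::zero) \<Rightarrow> bool" where
  "finsupp f \<longleftrightarrow> finite {a. f a \<noteq> 0}"

lemma finsupp_zero [simp]: "finsupp (0 :: 'a \<Rightarrow> 'k::comm_ring_1)"
  by (simp add: finsupp_def)

lemma finsupp_delta [simp]: "finsupp (delta a :: 'a \<Rightarrow> 'k::comm_ring_1)"
  by (simp add: finsupp_def delta_def)

lemma finsupp_add [simp]:
  fixes f g :: "'a \<Rightarrow> 'k::comm_ring_1"
  shows "finsupp f \<Longrightarrow> finsupp g \<Longrightarrow> finsupp (f + g)"
  unfolding finsupp_def
  by (rule finite_subset[of _ "{a. f a \<noteq> 0} \<union> {a. g a \<noteq> 0}"]) auto

lemma finsupp_scale [simp]: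
  fixes f :: "'a \<Rightarrow> 'k::comm_ring_1"
  shows "finsupp f \<Longrightarrow> finsupp (fscale c f)"
  unfolding finsupp_def
  by (rule finite_subset[of _ "{a. f a \<noteq> 0}"]) (auto simp: fscale_def)

lemma finsupp_diff [simp]:
  fixes f g :: "'a \<Rightarrow> 'k::comm_ring_1"
  shows "finsupp f \<Longrightarrow> finsupp g \<Longrightarrow> finsupp (f - g)"
  unfolding finsupp_def
  by (rule finite_subset[of _ "{a. f a \<noteq> 0} \<union> {a. g a \<noteq> 0}"]) auto

lemma subspace_finsupp: "fun_module.subspace {f :: 'a \<Rightarrow> 'k::comm_ring_1. finsupp f}"
  by (auto simp: fun_module.subspace_def)

lemma finsupp_sum [simp]:
  fixes f :: "'b \<Rightarrow> 'a \<Rightarrow> 'k::comm_ring_1"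
  shows "(\<And>i. i \<in> A \<Longrightarrow> finsupp (f i)) \<Longrightarrow> finsupp (\<Sum>i\<in>A. f i)"
  using fun_module.subspace_sum[OF subspace_finsupp, of A f] by simp

lemma finsupp_span:
  assumes "f \<in> fspan S" "\<And>s. s \<in> S \<Longrightarrow> finsupp s"
  shows "finsupp f"
  using fun_module.span_minimal[OF _ subspace_finsupp, of S] assms by auto

lemma finsupp_eq_sum:
  fixes f :: "'a \<Rightarrow> 'k::comm_ring_1"
  assumes "finsupp f"
  shows "f = (\<Sum>a\<in>{a. f a \<noteq> 0}. fscale (f a) (delta a))"
proof -
  have "(\<Sum>a\<in>{a. f a \<noteq> 0}. fscale (f a) (delta a)) b = f b" for b
    using assms
    by (simp add: sum_fun_apply fscale_def delta_def finsupp_def if_distrib cong: if_cong)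
  then show ?thesis by (auto simp: fun_eq_iff)
qed

lemma finsupp_induct [consumes 1, case_names zero delta add scale]:
  fixes f :: "'a \<Rightarrow> 'k::comm_ring_1"
  assumes "finsupp f" "P 0" "\<And>a. P (delta a)"
    "\<And>f g. finsupp f \<Longrightarrow> finsupp g \<Longrightarrow> P f \<Longrightarrow> P g \<Longrightarrow> P (f + g)"
    "\<And>c f. finsupp f \<Longrightarrow> P f \<Longrightarrow> P (fscale c f)"
  shows "P f"
proof -
  have "P (\<Sum>a\<in>A. fscale (f a) (delta a))" if "finite A" for A
    using that
  proof induction
    case empty
    then show ?case unfolding sum.empty by (rule assms(2))
  next
    case (insert x F)
    then show ?case unfolding sum.insert[OF insert.hyps]
      by (intro assms(3-5) finsupp_scale finsupp_delta finsupp_sum)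
  qed
  then show ?thesis
    using finsupp_eq_sum[OF assms(1)] assms(1) unfolding finsupp_def by metis
qed

text \<open>The sum over an infinite support is 0 by convention, so linearity in the last argument
  is available only for \<open>finsupp\<close> functions. Hence the finiteness conditions carried
  through later inductions.\<close>

definition lin_ext :: "('k::comm_ring_1 \<Rightarrow> 'b::ab_group_add \<Rightarrow> 'b) \<Rightarrow> ('a \<Rightarrow> 'b) \<Rightarrow> ('a \<Rightarrow> 'k) \<Rightarrow> 'b" where
  "lin_ext smul g f = (\<Sum>a\<in>{a. f a \<noteq> 0}. smul (f a) (g a))"

context module
begin

lemma lin_ext_eq_sum:
  assumes "finite A" "{a. f a \<noteq> 0} \<subseteq> A"
  shows "lin_ext scale g f = (\<Sum>a\<in>A. scale (f a) (g a))"
  unfolding lin_ext_def using assms by (intro sum.mono_neutral_left) auto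

lemma lin_ext_zero [simp]: "lin_ext scale g 0 = 0"
  by (simp add: lin_ext_def)

lemma lin_ext_delta [simp]: "lin_ext scale g (delta a) = g a"
  using lin_ext_eq_sum[of "{a}" "delta a" g] by (auto simp: delta_def)

lemma lin_ext_add [simp]:
  assumes "finsupp f" "finsupp h"
  shows "lin_ext scale g (f + h) = lin_ext scale g f + lin_ext scale g h"
proof -
  let ?A = "{a. f a \<noteq> 0} \<union> {a. h a \<noteq> 0}"
  have A: "finite ?A" using assms by (simp add: finsupp_def)
  have "lin_ext scale g u = (\<Sum>a\<in>?A. scale (u a) (g a))" if "u \<in> {f, h, f + h}" for u
    using that by (intro lin_ext_eq_sum A) auto
  then show ?thesis by (simp add: scale_left_distrib sum.distrib)
qed

lemma lin_ext_scale [simp]: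
  assumes "finsupp f"
  shows "lin_ext scale g (fscale c f) = scale c (lin_ext scale g f)"
proof -
  have A: "finite {a. f a \<noteq> 0}" using assms by (simp add: finsupp_def)
  have "lin_ext scale g u = (\<Sum>a\<in>{a. f a \<noteq> 0}. scale (u a) (g a))" if "u \<in> {f, fscale c f}" for u
    using that by (intro lin_ext_eq_sum A) (auto simp: fscale_def)
  then show ?thesis by (simp add: scale_sum_right fscale_def)
qed

lemma lin_ext_diff [simp]:
  assumes "finsupp f" "finsupp h"
  shows "lin_ext scale g (f - h) = lin_ext scale g f - lin_ext scale g h"
  using lin_ext_add[of "f - h" h g] assms by simp

lemma lin_ext_sum:
  assumes "\<And>i. i \<in> A \<Longrightarrow> finsupp (f i)"
  shows "lin_ext scale g (\<Sum>i\<in>A. f i) = (\<Sum>i\<in>A. lin_ext scale g (f i))"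
  using assms by (induction A rule: infinite_finite_induct) auto

text \<open>The finitely supported functions with image in \<open>V\<close> form a subspace, so
  checking the generators is enough.\<close>

lemma lin_ext_in_subspace:
  assumes "f \<in> fspan S" "subspace V" "\<And>s. s \<in> S \<Longrightarrow> finsupp s \<and> lin_ext scale g s \<in> V"
  shows "lin_ext scale g f \<in> V"
proof -
  have "fspan S \<subseteq> {f. finsupp f \<and> lin_ext scale g f \<in> V}"
  proof (rule fun_module.span_minimal)
    show "S \<subseteq> {f. finsupp f \<and> lin_ext scale g f \<in> V}" using assms(3) by auto
    show "fun_module.subspace {f. finsupp f \<and> lin_ext scale g f \<in> V}"
      using assms(2) by (auto simp: fun_module.subspace_def subspace_def)
  qed
  then show ?thesis using assms(1) by auto
qed

end

lemma finsupp_lin_ext [simp]: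
  assumes "\<And>a. finsupp (g a)"
  shows "finsupp (lin_ext fscale g f)"
  unfolding lin_ext_def by (intro finsupp_sum finsupp_scale assms)

section \<open>Words\<close>

text \<open>Left multiplication by a letter in the free algebra. Matching on the word makes it
  linear on all functions, whatever their support.\<close>

definition prep :: "'m \<Rightarrow> ('m list \<Rightarrow> 'k::comm_ring_1) \<Rightarrow> ('m list \<Rightarrow> 'k)" where
  "prep y f = (\<lambda>w. case w of [] \<Rightarrow> 0 | z # v \<Rightarrow> if z = y then f v else 0)"

lemma prep_delta [simp]: "prep y (delta w) = delta (y # w)"
  by (auto simp: prep_def delta_def fun_eq_iff split: list.split)

lemma prep_zero [simp]: "prep y 0 = 0"
  by (auto simp: prep_def fun_eq_iff split: list.split)

lemma prep_add [simp]: "prep y (f + g) = prep y f + prep y g"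
  by (auto simp: prep_def fun_eq_iff split: list.split)

lemma prep_diff [simp]: "prep y (f - g) = prep y f - prep y g"
  by (auto simp: prep_def fun_eq_iff split: list.split)

lemma prep_scale [simp]: "prep y (fscale c f) = fscale c (prep y f)"
  by (auto simp: prep_def fscale_def fun_eq_iff split: list.split)

lemma finsupp_prep [simp]: "finsupp f \<Longrightarrow> finsupp (prep y f)"
  by (induction f rule: finsupp_induct) (simp_all del: plus_fun_apply zero_fun_apply)

lemma prep_in_subspace:
  assumes "f \<in> fspan S" "fun_module.subspace V" "\<And>s. s \<in> S \<Longrightarrow> prep y s \<in> V"
  shows "prep y f \<in> V"
proof -
  have "fspan S \<subseteq> {f. prep y f \<in> V}"
    using assms(2,3) by (intro fun_module.span_minimal) (auto simp: fun_module.subspace_def)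
  then show ?thesis using assms(1) by auto
qed

text \<open>Every word grows from the empty one by left multiplication; this suits identities that
  follow from the Leibniz rule for \<open>prep\<close>.\<close>

lemma finsupp_word_induct [consumes 1, case_names zero Nil prep add scale]:
  fixes f :: "'m list \<Rightarrow> 'k::comm_ring_1"
  assumes "finsupp f" "P 0" "P (delta [])"
    "\<And>y f. finsupp f \<Longrightarrow> P f \<Longrightarrow> P (prep y f)"
    "\<And>f g. finsupp f \<Longrightarrow> finsupp g \<Longrightarrow> P f \<Longrightarrow> P g \<Longrightarrow> P (f + g)"
    "\<And>c f. finsupp f \<Longrightarrow> P f \<Longrightarrow> P (fscale c f)"
  shows "P f"
proof -
  have "P (delta w)" for w
  proof (induction w)
    case (Cons y w)
    then show ?case using assms(4)[of "delta w" y] by simp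
  qed (rule assms(3))
  with assms show ?thesis by (induction f rule: finsupp_induct) auto
qed

section \<open>Homogeneous components\<close>

definition degree_part :: "nat \<Rightarrow> ('m list \<Rightarrow> 'k::comm_ring_1) \<Rightarrow> ('m list \<Rightarrow> 'k)" where
  "degree_part n f = (\<lambda>w. if length w = n then f w else 0)"

lemma degree_part_linear [simp]:
  "degree_part n 0 = 0"
  "degree_part n (f + g) = degree_part n f + degree_part n g"
  "degree_part n (f - g) = degree_part n f - degree_part n g"
  "degree_part n (fscale c f) = fscale c (degree_part n f)"
  by (auto simp: degree_part_def fscale_def)

lemma degree_part_delta [simp]:
  "degree_part n (delta w) = (if length w = n then delta w else 0)"
  by (auto simp: degree_part_def delta_def)

lemma degree_part_in_subspace:
  assumes "f \<in> fspan S" "fun_module.subspace V" "\<And>s. s \<in> S \<Longrightarrow> degree_part n s \<in> V"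
  shows "degree_part n f \<in> V"
proof -
  have "fspan S \<subseteq> {f. degree_part n f \<in> V}"
    using assms(2,3) by (intro fun_module.span_minimal) (auto simp: fun_module.subspace_def)
  then show ?thesis using assms(1) by auto
qed

lemma degree_part_lower:
  assumes "f \<in> fspan {delta w | w. length w < n}"
  shows "degree_part n f = 0"
proof -
  have "degree_part n f \<in> {0}"
    by (rule degree_part_in_subspace[OF assms fun_module.subspace_single_0]) auto
  then show ?thesis by simp
qed

text \<open>Induction methods eta-expand terms of function type, which lets these rules destroy
  the module structure of the goals.\<close>

declare plus_fun_apply [simp del] zero_fun_apply [simp del] minus_apply [simp del]

text \<open>For \<open>L = UNIV\<close>, dividing the finitely supported functions by this span
  gives the symmetric algebra; \<open>L = {n}\<close> gives the denominator of
  \<open>Sym_pow\<close>.\<close>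

definition sym_ideal :: "('k::comm_ring_1 \<Rightarrow> 'm::ab_group_add \<Rightarrow> 'm) \<Rightarrow> nat set \<Rightarrow> ('m list \<Rightarrow> 'k) set" where
  "sym_ideal smul L = fspan (mult_rels smul L \<union> sym_rels L)"

lemma subspace_sym_ideal: "fun_module.subspace (sym_ideal smul L)"
  by (simp add: sym_ideal_def)

lemma mult_relsE:
  assumes "t \<in> mult_rels smul L"
  obtains (add) u x y v where "t = delta (u @ [x + y] @ v) - delta (u @ [x] @ v) - delta (u @ [y] @ v)"
      "length u + length v + 1 \<in> L"
  | (scale) u c x v where "t = delta (u @ [smul c x] @ v) - fscale c (delta (u @ [x] @ v))"
      "length u + length v + 1 \<in> L"
  using assms unfolding mult_rels_def by blast

lemma mult_relsI:
  "length u + length v + 1 \<in> L \<Longrightarrow>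
    delta (u @ [x + y] @ v) - delta (u @ [x] @ v) - delta (u @ [y] @ v) \<in> mult_rels smul L"
  "length u + length v + 1 \<in> L \<Longrightarrow>
    delta (u @ [smul c x] @ v) - fscale c (delta (u @ [x] @ v)) \<in> mult_rels smul L"
  unfolding mult_rels_def by blast+

lemma sym_relsE:
  assumes "t \<in> sym_rels L"
  obtains u x y v where "t = delta (u @ [x, y] @ v) - delta (u @ [y, x] @ v)"
      "length u + length v + 2 \<in> L"
  using assms unfolding sym_rels_def by blast

lemma sym_relsI:
  "length u + length v + 2 \<in> L \<Longrightarrow>
    delta (u @ [x, y] @ v) - delta (u @ [y, x] @ v) \<in> sym_rels L"
  unfolding sym_rels_def by blast

lemma weyl_relsE:
  assumes "t \<in> weyl_rels \<Phi>"
  obtains u x y v where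
    "t = delta (u @ [x, y] @ v) - delta (u @ [y, x] @ v) - fscale (\<Phi> x y) (delta (u @ v))"
  using assms unfolding weyl_rels_def by blast

lemma weyl_relsI:
  "delta (u @ [x, y] @ v) - delta (u @ [y, x] @ v) - fscale (\<Phi> x y) (delta (u @ v)) \<in> weyl_rels \<Phi>"
  unfolding weyl_rels_def by blast

lemma sym_idealI:
  "t \<in> mult_rels smul L \<Longrightarrow> t \<in> sym_ideal smul L" "t \<in> sym_rels L \<Longrightarrow> t \<in> sym_ideal smul L"
  by (auto simp: sym_ideal_def intro: fun_module.span_base)

lemma finsupp_rels:
  "t \<in> mult_rels smul L \<Longrightarrow> finsupp t" "t \<in> sym_rels L \<Longrightarrow> finsupp t"
  "t \<in> weyl_rels \<Phi> \<Longrightarrow> finsupp t"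
  by (auto elim!: mult_relsE sym_relsE weyl_relsE)

lemma finsupp_sym_ideal: "f \<in> sym_ideal smul L \<Longrightarrow> finsupp f"
  unfolding sym_ideal_def by (erule finsupp_span) (auto dest: finsupp_rels)

lemma prep_mult_rels:
  assumes "t \<in> mult_rels smul UNIV"
  shows "prep z t \<in> mult_rels smul UNIV"
  using assms
proof (cases rule: mult_relsE)
  case (add u x y v)
  then show ?thesis using mult_relsI(1)[of "z # u" v UNIV x y smul] by simp
next
  case (scale u c x v)
  then show ?thesis using mult_relsI(2)[of "z # u" v UNIV smul c x] by simp
qed

lemma prep_sym_rels:
  assumes "t \<in> sym_rels UNIV"
  shows "prep z t \<in> sym_rels UNIV"
  using assms
proof (cases rule: sym_relsE)
  case (1 u x y v)
  then show ?thesis using sym_relsI[of "z # u" v UNIV x y] by simp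
qed

lemma prep_sym_ideal:
  assumes "f \<in> sym_ideal smul UNIV"
  shows "prep z f \<in> sym_ideal smul UNIV"
  using assms unfolding sym_ideal_def
  by (rule prep_in_subspace)
    (auto intro!: fun_module.span_base dest: prep_mult_rels prep_sym_rels)

text \<open>On a single word these are defining relations with empty prefix, and each expression is
  linear in \<open>f\<close>. One induction treats all three.\<close>

lemma prep_letter_mod_sym_ideal:
  assumes "finsupp f"
  shows "prep (x + y) f - prep x f - prep y f \<in> sym_ideal smul UNIV"
    "prep (smul c x) f - fscale c (prep x f) \<in> sym_ideal smul UNIV"
    "prep x (prep y f) - prep y (prep x f) \<in> sym_ideal smul UNIV"
proof -
  define V where "V = {f. prep (x + y) f - prep x f - prep y f \<in> sym_ideal smul UNIV \<and>
    prep (smul c x) f - fscale c (prep x f) \<in> sym_ideal smul UNIV \<and>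
    prep x (prep y f) - prep y (prep x f) \<in> sym_ideal smul UNIV}"
  let ?J = "sym_ideal smul UNIV"
  have "f \<in> V" using assms
  proof (induction f rule: finsupp_induct)
    case zero
    then show ?case
      by (simp add: V_def fun_module.subspace_0[OF subspace_sym_ideal])
  next
    case (delta w)
    have "delta ((x + y) # w) - delta (x # w) - delta (y # w) \<in> ?J"
      using mult_relsI(1)[of "[]" w UNIV x y smul] by (simp add: sym_ideal_def fun_module.span_base)
    moreover have "delta (smul c x # w) - fscale c (delta (x # w)) \<in> ?J"
      using mult_relsI(2)[of "[]" w UNIV smul c x] by (simp add: sym_ideal_def fun_module.span_base)
    moreover have "delta (x # y # w) - delta (y # x # w) \<in> ?J"
      using sym_relsI[of "[]" w UNIV x y] by (intro sym_idealI(2)) simp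
    ultimately show ?case by (simp add: V_def)
  next
    case (add f g)
    have *: "prep (x + y) (f + g) - prep x (f + g) - prep y (f + g) =
        (prep (x + y) f - prep x f - prep y f) + (prep (x + y) g - prep x g - prep y g)"
      "prep (smul c x) (f + g) - fscale c (prep x (f + g)) =
        (prep (smul c x) f - fscale c (prep x f)) + (prep (smul c x) g - fscale c (prep x g))"
      "prep x (prep y (f + g)) - prep y (prep x (f + g)) =
        (prep x (prep y f) - prep y (prep x f)) + (prep x (prep y g) - prep y (prep x g))"
      by (simp_all add: fun_module.scale_right_distrib algebra_simps)
    from add show ?case unfolding V_def mem_Collect_eq *
      by (blast intro: fun_module.subspace_add[OF subspace_sym_ideal])
  next
    case (scale d f)
    have *: "prep (x + y) (fscale d f) - prep x (fscale d f) - prep y (fscale d f) =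
        fscale d (prep (x + y) f - prep x f - prep y f)"
      "prep (smul c x) (fscale d f) - fscale c (prep x (fscale d f)) =
        fscale d (prep (smul c x) f - fscale c (prep x f))"
      "prep x (prep y (fscale d f)) - prep y (prep x (fscale d f)) =
        fscale d (prep x (prep y f) - prep y (prep x f))"
      by (simp_all add: fun_module.scale_right_diff_distrib mult.commute)
    from scale show ?case unfolding V_def mem_Collect_eq *
      by (blast intro: fun_module.subspace_scale[OF subspace_sym_ideal])
  qed
  then show "prep (x + y) f - prep x f - prep y f \<in> ?J"
    "prep (smul c x) f - fscale c (prep x f) \<in> ?J"
    "prep x (prep y f) - prep y (prep x f) \<in> ?J"
    by (auto simp: V_def)
qed

text \<open>The generators are homogeneous, so taking a component either keeps a generator or kills
  it.\<close>

lemma degree_part_sym_ideal: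
  assumes "f \<in> sym_ideal smul UNIV"
  shows "degree_part n f \<in> sym_ideal smul {n}"
proof -
  have "degree_part n t \<in> sym_ideal smul {n}" if "t \<in> mult_rels smul UNIV \<union> sym_rels UNIV" for t
    using that
  proof
    assume "t \<in> mult_rels smul UNIV"
    then show ?thesis
    proof (cases rule: mult_relsE)
      case (add u x y v)
      then show ?thesis using mult_relsI(1)[of u v "{n}" x y smul]
        by (auto simp: sym_ideal_def fun_module.span_base fun_module.span_zero)
    next
      case (scale u c x v)
      then show ?thesis using mult_relsI(2)[of u v "{n}" smul c x]
        by (auto simp: sym_ideal_def fun_module.span_base fun_module.span_zero)
    qed
  next
    assume "t \<in> sym_rels UNIV"
    then show ?thesis
    proof (cases rule: sym_relsE)
      case (1 u x y v)
      show ?thesis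
      proof (cases "length u + length v + 2 = n")
        case True
        then have "degree_part n t = t" using 1 by simp
        also have "t \<in> sym_ideal smul {n}"
          unfolding 1(1) using True by (intro sym_idealI(2) sym_relsI) simp
        finally show ?thesis .
      next
        case False
        then show ?thesis using 1 by (simp add: sym_ideal_def fun_module.span_zero)
      qed
    qed
  qed
  then show ?thesis
    by (rule degree_part_in_subspace[OF assms[unfolded sym_ideal_def] subspace_sym_ideal])
qed

section \<open>The Weyl algebra of a difference of bilinear forms acts on the symmetric algebra\<close>

text \<open>The Leibniz rule, applied to the first letter. This derivation lives on the free
  algebra; \<open>deriv_sym_ideal\<close> lets it descend to the symmetric algebra.\<close>

primrec deriv_word :: "('m \<Rightarrow> 'm \<Rightarrow> 'k::comm_ring_1) \<Rightarrow> 'm \<Rightarrow> 'm list \<Rightarrow> ('m list \<Rightarrow> 'k)" where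
  "deriv_word B x [] = 0"
| "deriv_word B x (y # w) = fscale (B x y) (delta w) + prep y (deriv_word B x w)"

definition deriv :: "('m \<Rightarrow> 'm \<Rightarrow> 'k::comm_ring_1) \<Rightarrow> 'm \<Rightarrow> ('m list \<Rightarrow> 'k) \<Rightarrow> ('m list \<Rightarrow> 'k)" where
  "deriv B x = lin_ext fscale (deriv_word B x)"

lemma finsupp_deriv_word [simp]: "finsupp (deriv_word B x w)"
  by (induction w) simp_all

lemma finsupp_deriv [simp]: "finsupp (deriv B x f)"
  by (simp add: deriv_def)

lemma deriv_linear [simp]:
  "deriv B x 0 = 0"
  "finsupp f \<Longrightarrow> finsupp g \<Longrightarrow> deriv B x (f + g) = deriv B x f + deriv B x g"
  "finsupp f \<Longrightarrow> finsupp g \<Longrightarrow> deriv B x (f - g) = deriv B x f - deriv B x g"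
  "finsupp f \<Longrightarrow> deriv B x (fscale c f) = fscale c (deriv B x f)"
  "deriv B x (delta w) = deriv_word B x w"
  by (simp_all add: deriv_def fun_module.lin_ext_zero fun_module.lin_ext_add
      fun_module.lin_ext_diff fun_module.lin_ext_scale fun_module.lin_ext_delta)

lemma deriv_prep:
  assumes "finsupp f"
  shows "deriv B x (prep y f) = fscale (B x y) f + prep y (deriv B x f)"
  using assms
proof (induction f rule: finsupp_induct)
  case (add f g)
  then show ?case by (simp add: fun_module.scale_right_distrib)
next
  case (scale c f)
  then show ?case
    by (simp add: fun_module.scale_right_distrib mult.commute)
qed simp_all

text \<open>On \<open>prep z f\<close> both orders give \<open>B x z\<close> times the derivative
  along \<open>y\<close>, \<open>B y z\<close> times the derivative along \<open>x\<close>, and a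
  term settled by induction. The equality is exact, not merely modulo the ideal.\<close>

lemma deriv_commute:
  assumes "finsupp f"
  shows "deriv B x (deriv B y f) = deriv B y (deriv B x f)"
  using assms
  by (induction f rule: finsupp_word_induct)
    (simp_all add: deriv_prep ac_simps)

lemma deriv_letter:
  assumes "bilinear_form smul B" "finsupp f"
  shows "deriv B (x + y) f = deriv B x f + deriv B y f" (is ?add)
    and "deriv B (smul c x) f = fscale c (deriv B x f)" (is ?scale)
proof -
  have B: "B (x + y) z = B x z + B y z" "B (smul c x) z = c * B x z" for z
    using assms(1) by (simp_all add: bilinear_form_def)
  show ?add using assms(2)
    by (induction f rule: finsupp_word_induct)
      (simp_all add: deriv_prep B fun_module.scale_left_distrib fun_module.scale_right_distrib
        ac_simps)
  show ?scale using assms(2)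
    by (induction f rule: finsupp_word_induct)
      (simp_all add: deriv_prep B fun_module.scale_right_distrib mult.commute
       )
qed

text \<open>Induction on the prefix of a relation. With empty prefix, the terms that differentiate
  the displayed letters cancel, by linearity of \<open>B\<close> in its second argument or in pairs;
  what remains is a relation between left multiplications.\<close>

lemma deriv_sym_ideal:
  assumes B: "bilinear_form smul B" and "f \<in> sym_ideal smul UNIV"
  shows "deriv B z f \<in> sym_ideal smul UNIV"
proof -
  let ?J = "sym_ideal smul UNIV"
  have B': "B z (x + y) = B z x + B z y" "B z (smul c x) = c * B z x" for x y c
    using B by (simp_all add: bilinear_form_def)
  \<comment> \<open>The Leibniz rule yields a multiple of \<open>t\<close> besides the shifted
    derivative, so \<open>t\<close> itself has to lie in the ideal.\<close>
  have step: "deriv B z (prep y t) \<in> ?J" if "deriv B z t \<in> ?J" "t \<in> ?J" for y t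
    unfolding deriv_prep[OF finsupp_sym_ideal[OF that(2)]] using that
    by (intro fun_module.subspace_add[OF subspace_sym_ideal]
        fun_module.subspace_scale[OF subspace_sym_ideal] prep_sym_ideal)
  have add: "deriv B z (delta (u @ [x + y] @ v) - delta (u @ [x] @ v) - delta (u @ [y] @ v)) \<in> ?J"
    for u x y v
  proof (induction u)
    case Nil
    have eq: "deriv B z (delta ([] @ [x + y] @ v) - delta ([] @ [x] @ v) - delta ([] @ [y] @ v))
      = prep (x + y) (deriv_word B z v) - prep x (deriv_word B z v) - prep y (deriv_word B z v)"
      by (simp add: B' fun_module.scale_left_distrib)
    show ?case unfolding eq by (rule prep_letter_mod_sym_ideal) simp
  next
    case (Cons a u)
    from step[OF this sym_idealI(1)[OF mult_relsI(1)], of a] show ?case by simp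
  qed
  have scale: "deriv B z (delta (u @ [smul c x] @ v) - fscale c (delta (u @ [x] @ v))) \<in> ?J"
    for u c x v
  proof (induction u)
    case Nil
    have eq: "deriv B z (delta ([] @ [smul c x] @ v) - fscale c (delta ([] @ [x] @ v)))
      = prep (smul c x) (deriv_word B z v) - fscale c (prep x (deriv_word B z v))"
      by (simp add: B' fun_module.scale_right_distrib)
    show ?case unfolding eq by (rule prep_letter_mod_sym_ideal) simp
  next
    case (Cons a u)
    from step[OF this sym_idealI(1)[OF mult_relsI(2)], of a] show ?case by simp
  qed
  have sym: "deriv B z (delta (u @ [x, y] @ v) - delta (u @ [y, x] @ v)) \<in> ?J" for u x y v
  proof (induction u)
    case Nil
    have eq: "deriv B z (delta ([] @ [x, y] @ v) - delta ([] @ [y, x] @ v))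
      = prep x (prep y (deriv_word B z v)) - prep y (prep x (deriv_word B z v))"
      by simp
    show ?case unfolding eq by (rule prep_letter_mod_sym_ideal) simp
  next
    case (Cons a u)
    from step[OF this sym_idealI(2)[OF sym_relsI], of a] show ?case by simp
  qed
  have "finsupp t \<and> lin_ext fscale (deriv_word B z) t \<in> ?J"
    if t: "t \<in> mult_rels smul UNIV \<union> sym_rels UNIV" for t
  proof
    show "finsupp t" using t by (auto dest: finsupp_rels)
    show "lin_ext fscale (deriv_word B z) t \<in> ?J"
      using t add scale sym unfolding deriv_def
      by (auto elim!: mult_relsE sym_relsE simp del: append.simps)
  qed
  then show ?thesis unfolding deriv_def
    by (rule fun_module.lin_ext_in_subspace[OF assms(2)[unfolded sym_ideal_def] subspace_sym_ideal])
qed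

section \<open>Length bounds\<close>

lemma prep_words_shorter:
  assumes "f \<in> fspan {delta w | w. length w < n}"
  shows "prep y f \<in> fspan {delta w | w. length w < Suc n}"
  using assms by (rule prep_in_subspace) (auto intro!: fun_module.span_base)

lemma words_shorter_mono:
  "m \<le> n \<Longrightarrow> fspan {delta w | w. length w < m} \<subseteq> fspan {delta w | w. length w < n}"
  by (intro fun_module.span_mono) auto

lemma deriv_word_shorter: "deriv_word B x w \<in> fspan {delta v | v. length v < length w}"
proof (induction w)
  case (Cons y w)
  have "delta w \<in> fspan {delta v | v. length v < Suc (length w)}"
    by (auto intro: fun_module.span_base)
  moreover have "prep y (deriv_word B x w) \<in> fspan {delta v | v. length v < Suc (length w)}"
    by (rule prep_words_shorter[OF Cons])
  ultimately show ?case
    unfolding deriv_word.simps length_Cons by (intro fun_module.span_add fun_module.span_scale)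
qed (simp add: fun_module.span_zero)

lemma deriv_words_shorter:
  assumes "f \<in> fspan {delta w | w. length w < n}"
  shows "deriv B x f \<in> fspan {delta w | w. length w < n}"
  unfolding deriv_def using assms
proof (rule fun_module.lin_ext_in_subspace)
  fix s :: "'a list \<Rightarrow> 'b" assume "s \<in> {delta w | w. length w < n}"
  then obtain w where "s = delta w" "length w < n" by auto
  then show "finsupp s \<and> lin_ext fscale (deriv_word B x) s \<in> fspan {delta w | w. length w < n}"
    using deriv_word_shorter[of B x w] words_shorter_mono[of "length w" n]
    by (auto simp: fun_module.lin_ext_delta)
qed simp

section \<open>The operators by which letters of the Weyl algebra act\<close>

definition act :: "('m \<Rightarrow> 'm \<Rightarrow> 'k::comm_ring_1) \<Rightarrow> 'm \<Rightarrow> ('m list \<Rightarrow> 'k) \<Rightarrow> ('m list \<Rightarrow> 'k)" where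
  "act B x f = prep x f + deriv B x f"

lemma finsupp_act [simp]: "finsupp f \<Longrightarrow> finsupp (act B x f)"
  by (simp add: act_def)

lemma act_linear [simp]:
  "finsupp f \<Longrightarrow> finsupp g \<Longrightarrow> act B x (f + g) = act B x f + act B x g"
  "finsupp f \<Longrightarrow> finsupp g \<Longrightarrow> act B x (f - g) = act B x f - act B x g"
  "finsupp f \<Longrightarrow> act B x (fscale c f) = fscale c (act B x f)"
  by (simp_all add: act_def fun_module.scale_right_distrib)

lemma act_sym_ideal:
  assumes "bilinear_form smul B" "f \<in> sym_ideal smul UNIV"
  shows "act B x f \<in> sym_ideal smul UNIV"
  unfolding act_def
  by (intro fun_module.subspace_add[OF subspace_sym_ideal] prep_sym_ideal
      deriv_sym_ideal[OF assms(1)] assms(2))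

text \<open>The derivation part is exactly linear in the letter. In the commutator the derivations
  cancel and the mixed terms give \<open>B x y - B y x\<close>, so in each case only the defect of
  \<open>prep\<close> remains, which lies in the ideal.\<close>

lemma act_letter_mod_sym_ideal:
  assumes B: "bilinear_form smul B" and "finsupp f"
  shows "act B (x + y) f - act B x f - act B y f \<in> sym_ideal smul UNIV"
    and "act B (smul c x) f - fscale c (act B x f) \<in> sym_ideal smul UNIV"
    and "act B x (act B y f) - act B y (act B x f) - fscale (B x y - B y x) f \<in> sym_ideal smul UNIV"
proof -
  have "act B (x + y) f - act B x f - act B y f = prep (x + y) f - prep x f - prep y f"
    using deriv_letter[OF assms] by (simp add: act_def)
  then show "act B (x + y) f - act B x f - act B y f \<in> sym_ideal smul UNIV"
    using prep_letter_mod_sym_ideal(1)[OF assms(2)] by simp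
  have "act B (smul c x) f - fscale c (act B x f) = prep (smul c x) f - fscale c (prep x f)"
    using deriv_letter[OF assms] by (simp add: act_def fun_module.scale_right_distrib)
  then show "act B (smul c x) f - fscale c (act B x f) \<in> sym_ideal smul UNIV"
    using prep_letter_mod_sym_ideal(2)[OF assms(2)] by simp
  have "act B x (act B y f) - act B y (act B x f) - fscale (B x y - B y x) f
      = prep x (prep y f) - prep y (prep x f)"
    using assms(2) deriv_commute[OF assms(2), of B x y]
    by (simp add: act_def deriv_prep fun_module.scale_left_diff_distrib algebra_simps)
  then show "act B x (act B y f) - act B y (act B x f) - fscale (B x y - B y x) f
      \<in> sym_ideal smul UNIV"
    using prep_letter_mod_sym_ideal(3)[OF assms(2)] by simp
qed

primrec act_word :: "('m \<Rightarrow> 'm \<Rightarrow> 'k::comm_ring_1) \<Rightarrow> 'm list \<Rightarrow> ('m list \<Rightarrow> 'k)" where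
  "act_word B [] = delta []"
| "act_word B (x # w) = act B x (act_word B w)"

lemma finsupp_act_word [simp]: "finsupp (act_word B w)"
  by (induction w) simp_all

text \<open>Multiplication by a letter carries the leading word along, while the derivation does not
  raise the length and so stays below that of the longer word.\<close>

lemma act_word_leading: "act_word B w - delta w \<in> fspan {delta v | v. length v < length w}"
proof (induction w)
  case (Cons x w)
  have "act_word B w = (act_word B w - delta w) + delta w" by simp
  also have "\<dots> \<in> fspan {delta v | v. length v < Suc (length w)}"
    using Cons words_shorter_mono[of "length w" "Suc (length w)"]
    by (intro fun_module.span_add) (auto intro: fun_module.span_base)
  finally have "deriv B x (act_word B w) \<in> fspan {delta v | v. length v < Suc (length w)}"
    by (rule deriv_words_shorter)
  moreover have eq: "act_word B (x # w) - delta (x # w)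
      = prep x (act_word B w - delta w) + deriv B x (act_word B w)"
    by (simp add: act_def)
  moreover have "prep x (act_word B w - delta w) \<in> fspan {delta v | v. length v < Suc (length w)}"
    by (rule prep_words_shorter[OF Cons])
  ultimately show ?case
    unfolding eq length_Cons by (blast intro: fun_module.span_add)
qed (simp add: fun_module.span_zero)

text \<open>The map sends an element of the free algebra to its action on 1. Operators preserve the
  ideal, so prefixes can be stripped; a relation with suffix \<open>v\<close> then acts on
  \<open>act_word B v\<close>, where the letter congruences apply.\<close>

lemma weyl_ideal_acts_by_zero:
  assumes B: "bilinear_form smul B" and \<Phi>: "\<And>x y. \<Phi> x y = B x y - B y x"
    and f: "f \<in> weyl_ideal smul \<Phi>"
  shows "lin_ext fscale (act_word B) f \<in> sym_ideal smul UNIV"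
  using f unfolding weyl_ideal_def
proof (rule fun_module.lin_ext_in_subspace[OF _ subspace_sym_ideal])
  let ?J = "sym_ideal smul UNIV" and ?A = "lin_ext fscale (act_word B)"
  note lin = fun_module.lin_ext_diff fun_module.lin_ext_scale fun_module.lin_ext_delta
  have step: "?A (prep a t) \<in> ?J" if "?A t \<in> ?J" "finsupp t" for a t
  proof -
    have "?A (prep a t) = act B a (?A t)"
      using that(2)
    proof (induction t rule: finsupp_induct)
      case zero
      have "act B a 0 = 0" by (simp add: act_def)
      then show ?case by (simp add: fun_module.lin_ext_zero)
    qed (simp_all add: lin fun_module.lin_ext_add)
    with that(1) show ?thesis using act_sym_ideal[OF B] by simp
  qed
  have add: "?A (delta (u @ [x + y] @ v) - delta (u @ [x] @ v) - delta (u @ [y] @ v)) \<in> ?J" for u x y v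
  proof (induction u)
    case Nil
    then show ?case by (simp add: lin act_letter_mod_sym_ideal[OF B])
  next
    case (Cons a u)
    from step[OF this, of a] show ?case by simp
  qed
  have scale: "?A (delta (u @ [smul c x] @ v) - fscale c (delta (u @ [x] @ v))) \<in> ?J" for u c x v
  proof (induction u)
    case Nil
    then show ?case by (simp add: lin act_letter_mod_sym_ideal[OF B])
  next
    case (Cons a u)
    from step[OF this, of a] show ?case by simp
  qed
  have comm: "?A (delta (u @ [x, y] @ v) - delta (u @ [y, x] @ v) - fscale (\<Phi> x y) (delta (u @ v))) \<in> ?J"
    for u x y v
  proof (induction u)
    case Nil
    then show ?case by (simp add: lin \<Phi> act_letter_mod_sym_ideal[OF B])
  next
    case (Cons a u)
    from step[OF this, of a] show ?case by simp
  qed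
  fix t assume t: "t \<in> mult_rels smul UNIV \<union> weyl_rels \<Phi>"
  show "finsupp t \<and> ?A t \<in> ?J"
  proof
    show "finsupp t" using t by (auto dest: finsupp_rels)
    show "?A t \<in> ?J"
      using t add scale comm by (auto elim!: mult_relsE weyl_relsE simp del: append.simps)
  qed
qed

lemma SW_le_decomp:
  "SW_le smul \<Phi> n = {p + g | p g. p \<in> weyl_ideal smul \<Phi> \<and> g \<in> fspan {delta w | w. length w < n}}"
  unfolding SW_le_def fun_module.span_Un[of "weyl_ideal smul \<Phi>"]
  by (simp add: weyl_ideal_def fun_module.span_span)

text \<open>Let \<open>f = p + g\<close> act on 1 and compare components of degree \<open>n\<close>:
  \<open>f\<close> returns itself, \<open>g\<close> contributes nothing, and \<open>p\<close> gives
  an element of the graded ideal.\<close>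

lemma homogeneous_SW_le_of_difference_form:
  fixes smul :: "'k::comm_ring_1 \<Rightarrow> 'm::ab_group_add \<Rightarrow> 'm"
  assumes B: "bilinear_form smul B" and \<Phi>: "\<And>x y. \<Phi> x y = B x y - B y x"
    and f: "f \<in> fspan {delta w | w. length w = n}" "f \<in> SW_le smul \<Phi> n"
  shows "f \<in> sym_ideal smul {n}"
proof -
  let ?A = "lin_ext fscale (act_word B)" and ?L = "fspan {delta w | w. length w < n}"
  obtain p g where fpg: "f = p + g" and p: "p \<in> weyl_ideal smul \<Phi>" and g: "g \<in> ?L"
    using f(2) unfolding SW_le_decomp by auto
  have fin: "finsupp f" "finsupp g"
    using f(1) g by (auto elim!: finsupp_span)
  \<comment> \<open>Used twice: at length \<open>n\<close> it isolates the top component, and below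
    \<open>n\<close> it shows that the component of degree \<open>n\<close> vanishes.\<close>
  have leading: "\<exists>h \<in> ?L. act_word B w = h + delta w" if "length w \<le> n" for w
    using act_word_leading[of B w] words_shorter_mono[of "length w" n] that
    by (intro bexI[of _ "act_word B w - delta w"]) auto
  have "degree_part n (?A f) = f"
  proof -
    have "fspan {delta w | w. length w = n} \<subseteq> {f. finsupp f \<and> degree_part n (?A f) = f}"
    proof (rule fun_module.span_minimal)
      show "{delta w | w. length w = n} \<subseteq> {f. finsupp f \<and> degree_part n (?A f) = f}"
        using leading by (fastforce simp: fun_module.lin_ext_delta degree_part_lower)
    qed (auto simp: fun_module.subspace_def fun_module.lin_ext_zero fun_module.lin_ext_add
        fun_module.lin_ext_scale)
    with f(1) show ?thesis by auto
  qed
  moreover have "degree_part n (?A g) = 0"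
  proof (rule degree_part_lower, rule fun_module.lin_ext_in_subspace[OF g])
    fix s :: "'m list \<Rightarrow> 'k" assume "s \<in> {delta w | w. length w < n}"
    then obtain w where w: "s = delta w" "length w < n" by auto
    with leading[of w] obtain h where h: "h \<in> ?L" "act_word B w = h + delta w" by auto
    have "h + delta w \<in> ?L" using h w by (intro fun_module.span_add) (auto intro: fun_module.span_base)
    then show "finsupp s \<and> ?A s \<in> ?L"
      using w h by (simp add: fun_module.lin_ext_delta)
  qed simp
  moreover have "?A p = ?A f - ?A g"
    using fin fpg fun_module.lin_ext_diff[of f g "act_word B"] by simp
  ultimately have "f = degree_part n (?A p)" by simp
  then show ?thesis
    using degree_part_sym_ideal[OF weyl_ideal_acts_by_zero[OF B \<Phi> p], of n] by simp
qed

section \<open>The equational criterion for flatness\<close>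

text \<open>The map from coordinate vectors given by \<open>r\<close> generators. Coordinates from
  \<open>r\<close> on are ignored, so the rank may change while the type of vectors stays
  fixed.\<close>

definition lincomb :: "('k::comm_ring_1 \<Rightarrow> 'm::ab_group_add \<Rightarrow> 'm) \<Rightarrow> nat \<Rightarrow> (nat \<Rightarrow> 'm) \<Rightarrow> (nat \<Rightarrow> 'k) \<Rightarrow> 'm" where
  "lincomb smul r y v = (\<Sum>i<r. smul (v i) (y i))"

lemma module_mult: "module ((*) :: 'k::comm_ring_1 \<Rightarrow> 'k \<Rightarrow> 'k)"
  by unfold_locales (auto simp: algebra_simps)

lemma sum_mult_delta: "i < r \<Longrightarrow> (\<Sum>j<r. a j * delta i j) = a i"
  for a :: "nat \<Rightarrow> 'k::comm_ring_1"
  by (simp add: delta_def if_distrib cong: if_cong)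

text \<open>Linearity is required only where sums and multiples stay inside \<open>X\<close>; for
  finite \<open>X\<close> and \<open>C\<close> this amounts to finitely many relations, which
  flatness can handle.\<close>

definition local_section :: "('k::comm_ring_1 \<Rightarrow> 'm::ab_group_add \<Rightarrow> 'm) \<Rightarrow> 'm set \<Rightarrow> 'k set \<Rightarrow>
    ((nat \<Rightarrow> 'k) \<Rightarrow> 'm) \<Rightarrow> ('m \<Rightarrow> (nat \<Rightarrow> 'k)) \<Rightarrow> bool" where
  "local_section smul X C h s \<longleftrightarrow>
     (\<forall>x\<in>X. h (s x) = x) \<and>
     (\<forall>x\<in>X. \<forall>x'\<in>X. x + x' \<in> X \<longrightarrow> s (x + x') = s x + s x') \<and>
     (\<forall>c\<in>C. \<forall>x\<in>X. smul c x \<in> X \<longrightarrow> s (smul c x) = fscale c (s x))"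

lemma local_section_mono:
  "local_section smul X C h s \<Longrightarrow> X' \<subseteq> X \<Longrightarrow> C' \<subseteq> C \<Longrightarrow> local_section smul X' C' h s"
  unfolding local_section_def by blast

context module
begin

lemma lincomb_add: "lincomb scale r y (u + v) = lincomb scale r y u + lincomb scale r y v"
  by (simp add: lincomb_def plus_fun_apply scale_left_distrib sum.distrib)

lemma lincomb_diff: "lincomb scale r y (u - v) = lincomb scale r y u - lincomb scale r y v"
  by (simp add: lincomb_def minus_apply scale_left_diff_distrib sum_subtractf)

lemma lincomb_scale: "lincomb scale r y (fscale c v) = scale c (lincomb scale r y v)"
  by (simp add: lincomb_def fscale_def scale_sum_right)

lemma lincomb_delta: "i < r \<Longrightarrow> lincomb scale r y (delta i) = y i"
  by (simp add: lincomb_def delta_def if_distrib[of "\<lambda>c. scale c _"] sum.delta' cong: if_cong)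

lemma module_fun: "module (\<lambda>c (v :: nat \<Rightarrow> 'b) i. scale c (v i))"
  by unfold_locales
    (auto simp: fun_eq_iff plus_fun_apply scale_right_distrib scale_left_distrib)

text \<open>Tensoring the syzygy sequence of the ideal generated by the coefficients with the module:
  the pure tensor of \<open>c\<close> and \<open>x\<close> is sent to the vector of the products of \<open>x\<close> with
  chosen coefficients of \<open>c\<close>, which is well defined modulo multiples of syzygies.\<close>

lemma flat_relation_from_syzygies:
  assumes flat: "flat_module scale" and rel: "lincomb scale r y a = 0"
  shows "\<exists>r' b y'. (\<forall>j. (\<Sum>i<r. a i * b j i) = 0) \<and>
    (\<forall>i<r. y i = (\<Sum>j<r' :: nat. scale (b j i) (y' j)))"
proof -
  define fsc where "fsc = (\<lambda>c (v :: nat \<Rightarrow> 'b) i. scale c (v i))"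
  interpret V: module fsc unfolding fsc_def by (rule module_fun)
  define syz where "syz c \<longleftrightarrow> (\<Sum>i<r. a i * c i) = 0" for c
  define N where "N = V.span {(\<lambda>i. scale (c i) x) | c x. syz c}"
  have NI: "(\<lambda>i. scale (c i) x) \<in> N" if "syz c" for c x
    unfolding N_def using that by (intro V.span_base) auto
  define I where "I = range (\<lambda>c. \<Sum>i<r. a i * c i)"
  have I: "module.subspace (*) I"
  proof -
    show ?thesis
    proof (rule module.subspaceI[OF module_mult])
      show "0 \<in> I" unfolding I_def by (rule range_eqI[of _ _ 0]) (simp add: zero_fun_apply)
    next
      fix x y assume "x \<in> I" "y \<in> I"
      then obtain c d where "x = (\<Sum>i<r. a i * c i)" "y = (\<Sum>i<r. a i * d i)" by (auto simp: I_def)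
      then show "x + y \<in> I" unfolding I_def
        by (intro range_eqI[of _ _ "c + d"]) (simp add: plus_fun_apply distrib_left sum.distrib)
    next
      fix e x assume "x \<in> I"
      then obtain c where "x = (\<Sum>i<r. a i * c i)" by (auto simp: I_def)
      then show "e * x \<in> I" unfolding I_def
        by (intro range_eqI[of _ _ "fscale e c"]) (simp add: fscale_def sum_distrib_left ac_simps)
    qed
  qed
  \<comment> \<open>An arbitrary choice of coefficients. It need not be linear, but its failures to
    be linear are syzygies and are absorbed by \<open>N\<close>.\<close>
  define \<kappa> where "\<kappa> x = (SOME c. (\<Sum>i<r. a i * c i) = x)" for x
  have \<kappa>: "(\<Sum>i<r. a i * \<kappa> x i) = x" if x: "x \<in> I" for x
  proof -
    obtain c where "(\<Sum>i<r. a i * c i) = x" using x by (auto simp: I_def)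
    then show ?thesis unfolding \<kappa>_def by (rule someI[of "\<lambda>c. (\<Sum>i<r. a i * c i) = x"])
  qed
  have aI: "a i \<in> I" if "i < r" for i
    unfolding I_def
    by (rule range_eqI[of _ _ "delta i"])
      (simp add: sum_mult_delta that)
  define G where "G p = (\<lambda>i. scale (\<kappa> (fst p) i) (snd p))" for p
  \<comment> \<open>This represents the tensor \<open>\<Sum> a i \<otimes> y i\<close>, whose
    product is the given relation; flatness makes it zero in the tensor product.\<close>
  define f where "f = (\<Sum>i<r. delta (a i, y i) :: 'a \<times> 'b \<Rightarrow> 'a)"
  have "f \<in> tensor_free I"
    unfolding f_def tensor_free_def by (intro fun_module.span_sum fun_module.span_base) (auto simp: aI)
  moreover have "tensor_mult scale f = 0"
  proof -
    have "tensor_mult scale f = lin_ext scale (\<lambda>p. scale (fst p) (snd p)) f"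
      by (simp add: tensor_mult_def lin_ext_def)
    also have "\<dots> = (\<Sum>i<r. scale (a i) (y i))"
      unfolding f_def by (subst lin_ext_sum) auto
    finally show ?thesis using rel by (simp add: lincomb_def)
  qed
  ultimately have "f \<in> tensor_rels scale I" using flat I by (auto simp: flat_module_def)
  then have "lin_ext fsc G f \<in> N"
    unfolding tensor_rels_def
  proof (rule V.lin_ext_in_subspace)
    show "V.subspace N" by (simp add: N_def)
    fix s assume "s \<in> {delta (a + b, x) - delta (a, x) - delta (b, x) |a b x. a \<in> I \<and> b \<in> I} \<union>
        {delta (a, x + y) - delta (a, x) - delta (a, y) |a x y. a \<in> I} \<union>
        {delta (c * a, x) - fscale c (delta (a, x)) |c a x. a \<in> I} \<union>
        {delta (a, scale c x) - fscale c (delta (a, x)) |c a x. a \<in> I}"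
    then consider
      (1) p q x where "s = delta (p + q, x) - delta (p, x) - delta (q, x)" "p \<in> I" "q \<in> I"
      | (2) p x y where "s = delta (p, x + y) - delta (p, x) - delta (p, y)" "p \<in> I"
      | (3) c p x where "s = delta (c * p, x) - fscale c (delta (p, x))" "p \<in> I"
      | (4) c p x where "s = delta (p, scale c x) - fscale c (delta (p, x))" "p \<in> I"
      by blast
    then show "finsupp s \<and> lin_ext fsc G s \<in> N"
    proof cases
      case 1
      have "p + q \<in> I" using I 1(2,3) by (simp add: module.subspace_def[OF module_mult])
      then have "syz (\<lambda>i. \<kappa> (p + q) i - \<kappa> p i - \<kappa> q i)"
        using 1 by (simp add: syz_def right_diff_distrib sum_subtractf \<kappa>)
      moreover have "lin_ext fsc G s = G (p + q, x) - G (p, x) - G (q, x)"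
        unfolding 1(1) by simp
      moreover have "\<dots> = (\<lambda>i. scale (\<kappa> (p + q) i - \<kappa> p i - \<kappa> q i) x)"
        by (simp add: G_def fun_eq_iff minus_apply scale_left_diff_distrib)
      ultimately show ?thesis using 1(1) by (simp add: NI)
    next
      case 2
      have "lin_ext fsc G s = G (p, x + y) - G (p, x) - G (p, y)"
        unfolding 2(1) by simp
      also have "\<dots> = 0"
        by (simp add: G_def fun_eq_iff minus_apply zero_fun_apply scale_right_distrib)
      finally show ?thesis using 2 by (simp add: N_def V.span_zero)
    next
      case 3
      have "c * p \<in> I" using I 3(2) by (simp add: module.subspace_def[OF module_mult])
      then have "syz (\<lambda>i. \<kappa> (c * p) i - c * \<kappa> p i)"
        using \<kappa>[of p] 3(2)
        by (simp add: syz_def right_diff_distrib sum_subtractf \<kappa> mult.left_commute[of _ c]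
            flip: sum_distrib_left)
      moreover have "lin_ext fsc G s = G (c * p, x) - fsc c (G (p, x))"
        unfolding 3(1) by simp
      moreover have "\<dots> = (\<lambda>i. scale (\<kappa> (c * p) i - c * \<kappa> p i) x)"
        by (simp add: G_def fsc_def fun_eq_iff minus_apply scale_left_diff_distrib)
      ultimately show ?thesis using 3(1) by (simp add: NI)
    next
      case 4
      have "lin_ext fsc G s = G (p, scale c x) - fsc c (G (p, x))"
        unfolding 4(1) by simp
      also have "\<dots> = 0"
        by (simp add: G_def fsc_def fun_eq_iff minus_apply zero_fun_apply mult.commute)
      finally show ?thesis using 4 by (simp add: N_def V.span_zero)
    qed
  qed
  moreover have "lin_ext fsc G f = (\<Sum>j<r. G (a j, y j))"
    unfolding f_def by (subst V.lin_ext_sum) auto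
  \<comment> \<open>Both \<open>delta j\<close> and \<open>\<kappa> (a j)\<close> express
    \<open>a j\<close> through the coefficients, so they differ by a syzygy. Adding these
    corrections replaces the chosen coefficients by unit vectors and recovers
    \<open>y\<close>.\<close>
  moreover have "(\<Sum>j<r. (\<lambda>i. scale (delta j i - \<kappa> (a j) i) (y j))) \<in> N"
  proof -
    have "syz (\<lambda>i. delta j i - \<kappa> (a j) i)" if "j < r" for j
      using \<kappa>[OF aI[OF that]] that
      by (simp add: syz_def right_diff_distrib sum_subtractf sum_mult_delta)
    then show ?thesis unfolding N_def
      by (intro V.span_sum NI[unfolded N_def]) auto
  qed
  ultimately have "(\<Sum>j<r. G (a j, y j)) + (\<Sum>j<r. (\<lambda>i. scale (delta j i - \<kappa> (a j) i) (y j))) \<in> N"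
    unfolding N_def by (simp add: V.span_add)
  moreover have "(\<Sum>j<r. G (a j, y j)) + (\<Sum>j<r. (\<lambda>i. scale (delta j i - \<kappa> (a j) i) (y j)))
      = (\<lambda>i. if i < r then y i else 0)"
    by (simp add: fun_eq_iff plus_fun_apply sum_fun_apply G_def scale_left_diff_distrib sum_subtractf
        delta_def if_distrib[of "\<lambda>c. scale c _"] sum.delta cong: if_cong)
  ultimately have mem: "(\<lambda>i. if i < r then y i else 0) \<in> N" by simp
  have "\<exists>r' b y'. (\<forall>j. syz (b j)) \<and> (\<forall>i. v i = (\<Sum>j<r' :: nat. scale (b j i) (y' j)))" if "v \<in> N" for v
    using that unfolding N_def
  proof (induction rule: V.span_induct_alt)
    case base
    show ?case by (rule exI[of _ 0], rule exI[of _ "\<lambda>_ _. 0"]) (simp add: zero_fun_apply syz_def)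
  next
    case (step e x v)
    obtain c z where x: "x = (\<lambda>i. scale (c i) z)" and c: "syz c" using step(1) by auto
    obtain r' :: nat and b y' where b: "\<forall>j. syz (b j)" "\<And>i. v i = (\<Sum>j<r'. scale (b j i) (y' j))"
      using step(2) by blast
    show ?case
      \<comment> \<open>The scalar \<open>e\<close> is absorbed into the new module element, which
        leaves the syzygy \<open>c\<close> unchanged.\<close>
      by (rule exI[of _ "Suc r'"], rule exI[of _ "b(r' := c)"], rule exI[of _ "y'(r' := scale e z)"])
        (use b c x in \<open>auto simp: fsc_def plus_fun_apply mult.commute\<close>)
  qed
  from this[OF mem] obtain r' :: nat and b y' where b: "\<And>j. syz (b j)"
      and y': "\<And>i. (if i < r then y i else 0) = (\<Sum>j<r'. scale (b j i) (y' j))"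
    by blast
  have "(\<Sum>i<r. a i * b j i) = 0" for j using b by (simp add: syz_def)
  moreover have "y i = (\<Sum>j<r'. scale (b j i) (y' j))" if "i < r" for i using y'[of i] that by simp
  ultimately show ?thesis by blast
qed

text \<open>The matrix \<open>b\<close> defines \<open>L\<close>: expressing each \<open>y i\<close>
  through the \<open>y'\<close> makes the old map factor through \<open>L\<close>, and the syzygy
  condition says that \<open>L\<close> kills \<open>a\<close>.\<close>

lemma flat_kill_relation:
  assumes flat: "flat_module scale" and rel: "lincomb scale r y a = 0"
  shows "\<exists>r' y' L. module_hom fscale fscale (L :: (nat \<Rightarrow> 'a) \<Rightarrow> (nat \<Rightarrow> 'a)) \<and>
    (\<forall>v. lincomb scale r' y' (L v) = lincomb scale r y v) \<and> L a = 0"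
proof -
  obtain r' :: nat and b y' where b: "\<And>j. (\<Sum>i<r. a i * b j i) = 0"
    and y: "\<And>i. i < r \<Longrightarrow> y i = (\<Sum>j<r'. scale (b j i) (y' j))"
    using flat_relation_from_syzygies[OF assms] by blast
  define L where "L v = (\<lambda>j. \<Sum>i<r. v i * b j i)" for v
  show ?thesis
  proof (intro exI[of _ r'] exI[of _ y'] exI[of _ L] conjI allI)
    show "module_hom fscale fscale L"
      by unfold_locales
        (auto simp: L_def fun_eq_iff fscale_def plus_fun_apply distrib_right sum.distrib
          sum_distrib_left mult.assoc)
    show "L a = 0" using b by (simp add: L_def zero_fun_def)
    fix v
    have "lincomb scale r' y' (L v) = (\<Sum>j<r'. \<Sum>i<r. scale (v i) (scale (b j i) (y' j)))"
      by (simp add: lincomb_def L_def scale_sum_left)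
    also have "\<dots> = (\<Sum>i<r. \<Sum>j<r'. scale (v i) (scale (b j i) (y' j)))"
      by (rule sum.swap)
    also have "\<dots> = lincomb scale r y v"
      by (simp add: lincomb_def y scale_sum_right)
    finally show "lincomb scale r' y' (L v) = lincomb scale r y v" .
  qed
qed

text \<open>Relations are killed one at a time: the image of the next one is a relation among the
  new generators, and linear maps keep the earlier ones at zero.\<close>

lemma flat_kill_relations:
  assumes flat: "flat_module scale" and "finite K" "\<And>a. a \<in> K \<Longrightarrow> lincomb scale r y a = 0"
  shows "\<exists>r' y' L. module_hom fscale fscale (L :: (nat \<Rightarrow> 'a) \<Rightarrow> (nat \<Rightarrow> 'a)) \<and>
    (\<forall>v. lincomb scale r' y' (L v) = lincomb scale r y v) \<and> (\<forall>a\<in>K. L a = 0)"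
  using assms(2,3)
proof (induction K rule: finite_induct)
  case empty
  have "module_hom fscale fscale (\<lambda>v :: nat \<Rightarrow> 'a. v)" by unfold_locales auto
  then show ?case by auto
next
  case (insert a K)
  obtain r1 y1 L1
    where 1: "module_hom fscale fscale (L1 :: (nat \<Rightarrow> 'a) \<Rightarrow> (nat \<Rightarrow> 'a))"
      "\<And>v. lincomb scale r1 y1 (L1 v) = lincomb scale r y v" "\<And>a. a \<in> K \<Longrightarrow> L1 a = 0"
    using insert.IH[OF insert.prems] by blast
  have "lincomb scale r1 y1 (L1 a) = 0" using 1(2) insert.prems by simp
  from flat_kill_relation[OF flat this] obtain r2 y2 L2
    where 2: "module_hom fscale fscale (L2 :: (nat \<Rightarrow> 'a) \<Rightarrow> (nat \<Rightarrow> 'a))"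
      "\<And>v. lincomb scale r2 y2 (L2 v) = lincomb scale r1 y1 v" "L2 (L1 a) = 0"
    by blast
  have "module_hom fscale fscale (L2 \<circ> L1)" using module_hom_compose[OF 1(1) 2(1)] .
  moreover have "L2 0 = 0" using module_hom.zero[OF 2(1)] .
  ultimately show ?case using 1 2
    by (intro exI[of _ r2] exI[of _ y2] exI[of _ "L2 \<circ> L1"]) (simp del: o_apply, simp)
qed

text \<open>Start with one basis vector per element of \<open>X\<close>. Its failures of additivity
  and homogeneity, collected in \<open>K1\<close> and \<open>K2\<close>, are finitely many
  relations; a map \<open>L\<close> that kills them turns the basis vectors into a local
  section.\<close>

lemma flat_local_section:
  assumes flat: "flat_module scale" and X: "finite X" and C: "finite C"
  shows "\<exists>r y s. local_section scale X C (lincomb scale r y) s"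
proof -
  obtain r :: nat and e where e: "e ` X = {i. i < r}" "inj_on e X"
    using finite_imp_inj_to_nat_seg[OF X] by auto
  define h where "h = lincomb scale r (inv_into X e)"
  have h: "h (delta (e x)) = x" if "x \<in> X" for x
  proof -
    have "e x < r" using that e(1) by blast
    then show ?thesis using that e(2) by (simp add: h_def lincomb_delta)
  qed
  define K1 where "K1 = (\<lambda>(x, x'). delta (e (x + x')) - delta (e x) - delta (e x') :: nat \<Rightarrow> 'a)
    ` {(x, x'). x \<in> X \<and> x' \<in> X \<and> x + x' \<in> X}"
  define K2 where "K2 = (\<lambda>(c, x). delta (e (scale c x)) - fscale c (delta (e x)))
    ` {(c, x). c \<in> C \<and> x \<in> X \<and> scale c x \<in> X}"
  have "finite {(x, x'). x \<in> X \<and> x' \<in> X \<and> x + x' \<in> X}"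
    by (rule finite_subset[of _ "X \<times> X"]) (use X in auto)
  moreover have "finite {(c, x). c \<in> C \<and> x \<in> X \<and> scale c x \<in> X}"
    by (rule finite_subset[of _ "C \<times> X"]) (use X C in auto)
  ultimately have "finite (K1 \<union> K2)" by (simp add: K1_def K2_def)
  moreover have "h a = 0" if "a \<in> K1 \<union> K2" for a
    using that h[unfolded h_def]
    by (auto simp: K1_def K2_def h_def lincomb_diff lincomb_scale)
  ultimately obtain r' y' L where L: "module_hom fscale fscale (L :: (nat \<Rightarrow> 'a) \<Rightarrow> (nat \<Rightarrow> 'a))"
      "\<And>v. lincomb scale r' y' (L v) = h v" "\<And>a. a \<in> K1 \<union> K2 \<Longrightarrow> L a = 0"
    using flat_kill_relations[OF flat, of "K1 \<union> K2" r "inv_into X e"] unfolding h_def by blast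
  have "local_section scale X C (lincomb scale r' y') (\<lambda>x. L (delta (e x)))"
    unfolding local_section_def
  proof (intro conjI ballI impI)
    fix x assume x: "x \<in> X"
    then show "lincomb scale r' y' (L (delta (e x))) = x" by (simp add: L(2) h)
    show "L (delta (e (x + x'))) = L (delta (e x)) + L (delta (e x'))" if "x' \<in> X" "x + x' \<in> X" for x'
    proof -
      have "L (delta (e (x + x')) - delta (e x) - delta (e x')) = 0"
        using x that by (intro L(3)) (auto simp: K1_def)
      then show ?thesis unfolding module_hom.diff[OF L(1)] by (simp add: algebra_simps)
    qed
    show "L (delta (e (scale c x))) = fscale c (L (delta (e x)))" if "c \<in> C" "scale c x \<in> X" for c
    proof -
      have "L (delta (e (scale c x)) - fscale c (delta (e x))) = 0"
        using x that by (intro L(3)) (auto simp: K2_def)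
      then show ?thesis by (simp add: module_hom.diff[OF L(1)] module_hom.scale[OF L(1)])
    qed
  qed
  then show ?thesis by blast
qed

end

section \<open>Lifting relations to a free module\<close>

text \<open>Any function on letters is allowed, because a local section need not be linear.\<close>

definition wmap :: "('m \<Rightarrow> 'n) \<Rightarrow> ('m list \<Rightarrow> 'k::comm_ring_1) \<Rightarrow> ('n list \<Rightarrow> 'k)" where
  "wmap s = lin_ext fscale (\<lambda>w. delta (map s w))"

lemma finsupp_wmap [simp]: "finsupp (wmap s f)"
  by (simp add: wmap_def)

lemma wmap_linear [simp]:
  "wmap s 0 = 0"
  "wmap s (delta w) = delta (map s w)"
  "finsupp f \<Longrightarrow> finsupp g \<Longrightarrow> wmap s (f + g) = wmap s f + wmap s g"
  "finsupp f \<Longrightarrow> finsupp g \<Longrightarrow> wmap s (f - g) = wmap s f - wmap s g"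
  "finsupp f \<Longrightarrow> wmap s (fscale c f) = fscale c (wmap s f)"
  by (simp_all add: wmap_def fun_module.lin_ext_zero fun_module.lin_ext_add
      fun_module.lin_ext_diff fun_module.lin_ext_scale fun_module.lin_ext_delta)

lemma wmap_in_span_words:
  assumes "f \<in> fspan {delta w | w. P (length w)}"
  shows "wmap s f \<in> fspan {delta w | w. P (length w)}"
  using assms unfolding wmap_def
proof (rule fun_module.lin_ext_in_subspace)
  fix t :: "'a list \<Rightarrow> 'b" assume "t \<in> {delta w | w. P (length w)}"
  then obtain w where "t = delta w" "P (length w)" by auto
  moreover from this have "delta (map s w) \<in> fspan {delta w | w. P (length w)}"
    by (intro fun_module.span_base) (auto intro!: exI[of _ "map s w"])
  ultimately show "finsupp t \<and> lin_ext fscale (\<lambda>w. delta (map s w)) t \<in> fspan {delta w | w. P (length w)}"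
    by (simp add: fun_module.lin_ext_delta)
qed simp

lemma wmap_sym_ideal:
  assumes add: "\<And>x y. h (x + y) = h x + h y" and scale: "\<And>c x. h (smul c x) = smul' c (h x)"
    and f: "f \<in> sym_ideal smul L"
  shows "wmap h f \<in> sym_ideal smul' L"
proof -
  have "finsupp t \<and> lin_ext fscale (\<lambda>w. delta (map h w)) t \<in> sym_ideal smul' L"
    if t: "t \<in> mult_rels smul L \<union> sym_rels L" for t
  proof
    show "finsupp t" using t by (auto dest: finsupp_rels)
    have "wmap h t \<in> sym_ideal smul' L"
      using t
    proof
      assume "t \<in> mult_rels smul L"
      then show ?thesis
      proof (cases rule: mult_relsE)
        case (add u x y v)
        then have "wmap h t = delta (map h u @ [h x + h y] @ map h v) - delta (map h u @ [h x] @ map h v)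
            - delta (map h u @ [h y] @ map h v)"
          by (simp add: assms(1))
        also have "\<dots> \<in> sym_ideal smul' L"
          using add by (intro sym_idealI(1) mult_relsI(1)) simp
        finally show ?thesis .
      next
        case (scale u c x v)
        then have "wmap h t = delta (map h u @ [smul' c (h x)] @ map h v)
            - fscale c (delta (map h u @ [h x] @ map h v))"
          by (simp add: assms(2))
        also have "\<dots> \<in> sym_ideal smul' L"
          using scale by (intro sym_idealI(1) mult_relsI(2)) simp
        finally show ?thesis .
      qed
    next
      assume "t \<in> sym_rels L"
      then show ?thesis
      proof (cases rule: sym_relsE)
        case (1 u x y v)
        then have "wmap h t = delta (map h u @ [h x, h y] @ map h v) - delta (map h u @ [h y, h x] @ map h v)"
          by simp
        also have "\<dots> \<in> sym_ideal smul' L"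
          using 1 by (intro sym_idealI(2) sym_relsI) simp
        finally show ?thesis .
      qed
    qed
    then show "lin_ext fscale (\<lambda>w. delta (map h w)) t \<in> sym_ideal smul' L" by (simp add: wmap_def)
  qed
  then show ?thesis unfolding wmap_def
    by (rule fun_module.lin_ext_in_subspace[OF f[unfolded sym_ideal_def] subspace_sym_ideal])
qed

text \<open>Only the letters occurring in \<open>f\<close> matter. The set \<open>X\<close> is fixed
  before \<open>h\<close> and \<open>s\<close>, since the section is constructed later to suit
  it.\<close>

lemma wmap_section:
  fixes f :: "'m list \<Rightarrow> 'k::comm_ring_1"
  assumes "finsupp f"
  shows "\<exists>X. finite X \<and> (\<forall>h (s :: 'm \<Rightarrow> 'n). (\<forall>x\<in>X. h (s x) = x) \<longrightarrow> wmap h (wmap s f) = f)"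
  using assms
proof (induction f rule: finsupp_induct)
  case zero
  show ?case by (intro exI[of _ "{}"]) simp
next
  case (delta w)
  show ?case by (intro exI[of _ "set w"]) (simp add: map_idI)
next
  case (add f g)
  from add(3) obtain X where X: "finite X"
    "\<And>h (s :: 'm \<Rightarrow> 'n). (\<forall>x\<in>X. h (s x) = x) \<Longrightarrow> wmap h (wmap s f) = f" by blast
  from add(4) obtain Y where Y: "finite Y"
    "\<And>h (s :: 'm \<Rightarrow> 'n). (\<forall>x\<in>Y. h (s x) = x) \<Longrightarrow> wmap h (wmap s g) = g" by blast
  show ?case using add(1,2) X Y by (intro exI[of _ "X \<union> Y"]) simp
next
  case (scale c f)
  then show ?case by auto
qed

text \<open>\<open>X\<close> and \<open>C\<close> record the letters and scalars tied together by
  the relation. For a commutator, \<open>h (s x) = x\<close> makes the pulled back form take the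
  value \<open>\<Phi> x y\<close>.\<close>

lemma weyl_relation_lifts:
  fixes smul :: "'k::comm_ring_1 \<Rightarrow> 'm::ab_group_add \<Rightarrow> 'm"
  assumes "t \<in> mult_rels smul UNIV \<union> weyl_rels \<Phi>"
  shows "\<exists>X C. finite X \<and> finite C \<and> (\<forall>h s. local_section smul X C h s \<longrightarrow>
    wmap s t \<in> weyl_ideal fscale (\<lambda>a b. \<Phi> (h a) (h b)))"
  using assms
proof
  assume "t \<in> mult_rels smul UNIV"
  then show ?thesis
  proof (cases rule: mult_relsE)
    case (add u x y v)
    have "wmap s t \<in> weyl_ideal fscale (\<lambda>a b. \<Phi> (h a) (h b))"
      if "local_section smul {x, y, x + y} {} h s" for h s
    proof -
      have "s (x + y) = s x + s y" using that by (auto simp: local_section_def)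
      then have "wmap s t = delta (map s u @ [s x + s y] @ map s v) - delta (map s u @ [s x] @ map s v)
          - delta (map s u @ [s y] @ map s v)"
        using add by simp
      also have "\<dots> \<in> mult_rels fscale UNIV" by (intro mult_relsI(1)) simp
      finally show ?thesis by (simp add: weyl_ideal_def fun_module.span_base)
    qed
    then show ?thesis by (intro exI[of _ "{x, y, x + y}"] exI[of _ "{}"]) simp
  next
    case (scale u c x v)
    have "wmap s t \<in> weyl_ideal fscale (\<lambda>a b. \<Phi> (h a) (h b))"
      if "local_section smul {x, smul c x} {c} h s" for h s
    proof -
      have "s (smul c x) = fscale c (s x)" using that by (auto simp: local_section_def)
      then have "wmap s t = delta (map s u @ [fscale c (s x)] @ map s v)
          - fscale c (delta (map s u @ [s x] @ map s v))"
        using scale by simp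
      also have "\<dots> \<in> mult_rels fscale UNIV" by (intro mult_relsI(2)) simp
      finally show ?thesis by (simp add: weyl_ideal_def fun_module.span_base)
    qed
    then show ?thesis by (intro exI[of _ "{x, smul c x}"] exI[of _ "{c}"]) simp
  qed
next
  assume "t \<in> weyl_rels \<Phi>"
  then show ?thesis
  proof (cases rule: weyl_relsE)
    case (1 u x y v)
    have "wmap s t \<in> weyl_ideal fscale (\<lambda>a b. \<Phi> (h a) (h b))"
      if "local_section smul {x, y} {} h s" for h s
    proof -
      have "h (s x) = x" "h (s y) = y" using that by (auto simp: local_section_def)
      then have "wmap s t = delta (map s u @ [s x, s y] @ map s v) - delta (map s u @ [s y, s x] @ map s v)
          - fscale (\<Phi> (h (s x)) (h (s y))) (delta (map s u @ map s v))"
        using 1 by simp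
      also have "\<dots> \<in> weyl_rels (\<lambda>a b. \<Phi> (h a) (h b))"
        by (rule weyl_relsI[where \<Phi> = "\<lambda>a b. \<Phi> (h a) (h b)"])
      finally show ?thesis by (simp add: weyl_ideal_def fun_module.span_base)
    qed
    then show ?thesis by (intro exI[of _ "{x, y}"] exI[of _ "{}"]) simp
  qed
qed

text \<open>An element of the ideal combines finitely many relations, so the union of their finite
  conditions is still finite.\<close>

lemma weyl_ideal_lifts:
  fixes smul :: "'k::comm_ring_1 \<Rightarrow> 'm::ab_group_add \<Rightarrow> 'm"
  assumes "p \<in> weyl_ideal smul \<Phi>"
  shows "finsupp p \<and> (\<exists>X C. finite X \<and> finite C \<and> (\<forall>h s. local_section smul X C h s \<longrightarrow>
    wmap s p \<in> weyl_ideal fscale (\<lambda>a b. \<Phi> (h a) (h b))))"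
  using assms unfolding weyl_ideal_def[of smul]
proof (induction rule: fun_module.span_induct_alt)
  case base
  have "wmap s 0 \<in> weyl_ideal fscale (\<lambda>a b. \<Phi> (h a) (h b))" for h and s :: "'m \<Rightarrow> nat \<Rightarrow> 'k"
    by (simp add: weyl_ideal_def fun_module.span_zero)
  then show ?case by (auto intro!: exI[of _ "{}"])
next
  case (step c t p)
  have t: "finsupp t" using step(1) by (auto dest: finsupp_rels)
  obtain X C where 1: "finite X" "finite C"
    "\<And>h s. local_section smul X C h s \<Longrightarrow> wmap s t \<in> weyl_ideal fscale (\<lambda>a b. \<Phi> (h a) (h b))"
    using weyl_relation_lifts[OF step(1)] by blast
  obtain Y D where 2: "finite Y" "finite D" "finsupp p"
    "\<And>h s. local_section smul Y D h s \<Longrightarrow> wmap s p \<in> weyl_ideal fscale (\<lambda>a b. \<Phi> (h a) (h b))"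
    using step(2) by blast
  have "wmap s (fscale c t + p) \<in> weyl_ideal fscale (\<lambda>a b. \<Phi> (h a) (h b))"
    if "local_section smul (X \<union> Y) (C \<union> D) h s" for h s
  proof -
    have "wmap s t \<in> weyl_ideal fscale (\<lambda>a b. \<Phi> (h a) (h b))"
      "wmap s p \<in> weyl_ideal fscale (\<lambda>a b. \<Phi> (h a) (h b))"
      by (rule 1(3) 2(4), rule local_section_mono[OF that]; simp)+
    then show ?thesis using t 2(3)
      by (simp add: weyl_ideal_def fun_module.span_add fun_module.span_scale)
  qed
  then show ?case using 1 2 t
    by (intro conjI exI[of _ "X \<union> Y"] exI[of _ "C \<union> D"]) auto
qed

text \<open>On a free module an alternating form is the antisymmetrisation of its strictly upper
  triangular part; no division by two is needed.\<close>

lemma (in module) alternating_pullback_difference_form: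
  assumes bil: "bilinear_form scale \<Phi>" and alt: "\<forall>x. \<Phi> x x = 0"
  shows "\<exists>B. bilinear_form fscale B \<and>
    (\<forall>a b. \<Phi> (lincomb scale r y a) (lincomb scale r y b) = B a b - B b a)"
proof -
  have add: "\<Phi> (x + x') z = \<Phi> x z + \<Phi> x' z" "\<Phi> z (x + x') = \<Phi> z x + \<Phi> z x'"
    and sc: "\<Phi> (scale c x) z = c * \<Phi> x z" "\<Phi> z (scale c x) = c * \<Phi> z x" for x x' z c
    using bil by (auto simp: bilinear_form_def)
  have zero: "\<Phi> 0 z = 0" "\<Phi> z 0 = 0" for z
    using sc(1)[of 0 0 z] sc(2)[of z 0 0] by auto
  have suml: "\<Phi> (\<Sum>i<n. f i) z = (\<Sum>i<n. \<Phi> (f i) z)" for f z and n :: nat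
    by (induction n) (auto simp: zero add)
  have sumr: "\<Phi> z (\<Sum>i<n. f i) = (\<Sum>i<n. \<Phi> z (f i))" for f z and n :: nat
    by (induction n) (auto simp: zero add)
  have skew: "\<Phi> x z = - \<Phi> z x" for x z
  proof -
    have "\<Phi> x z + \<Phi> z x = \<Phi> (x + z) (x + z)" unfolding add using alt by simp
    also have "\<dots> = 0" by (rule alt[rule_format])
    finally show ?thesis by (simp only: eq_neg_iff_add_eq_0)
  qed
  define T where "T a b i j = (if i < j then a i * b j * \<Phi> (y i) (y j) else 0)"
    for a b :: "nat \<Rightarrow> 'a" and i j :: nat
  define B where "B a b = (\<Sum>i<r. \<Sum>j<r. T a b i j)" for a b
  have "bilinear_form fscale B"
    unfolding bilinear_form_def
  proof (intro conjI allI)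
    fix a b d :: "nat \<Rightarrow> 'a" and c :: 'a
    have "T (a + b) d i j = T a d i j + T b d i j" for i j
      by (simp add: T_def plus_fun_apply distrib_right)
    then show "B (a + b) d = B a d + B b d" by (simp add: B_def sum.distrib)
    have "T a (b + d) i j = T a b i j + T a d i j" for i j
      by (simp add: T_def plus_fun_apply distrib_left distrib_right)
    then show "B a (b + d) = B a b + B a d" by (simp add: B_def sum.distrib)
    have "T (fscale c a) b i j = c * T a b i j" for i j
      by (simp add: T_def fscale_def mult.assoc)
    then show "B (fscale c a) b = c * B a b" by (simp add: B_def sum_distrib_left)
    have "T a (fscale c b) i j = c * T a b i j" for i j
      by (simp add: T_def fscale_def ac_simps)
    then show "B a (fscale c b) = c * B a b" by (simp add: B_def sum_distrib_left)
  qed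
  moreover have "\<Phi> (lincomb scale r y a) (lincomb scale r y b) = B a b - B b a" for a b
  proof -
    have "\<Phi> (lincomb scale r y a) (lincomb scale r y b)
        = (\<Sum>i<r. \<Sum>j<r. a i * b j * \<Phi> (y i) (y j))"
      unfolding lincomb_def suml by (simp add: sumr sc ac_simps sum_distrib_left)
    \<comment> \<open>Above the diagonal the first term survives, below it the second by skewness;
      on the diagonal the form vanishes.\<close>
    also have "\<dots> = (\<Sum>i<r. \<Sum>j<r. T a b i j - T b a j i)"
    proof (intro sum.cong refl)
      fix i j
      show "a i * b j * \<Phi> (y i) (y j) = T a b i j - T b a j i"
      proof (cases i j rule: linorder_cases)
        case greater
        then show ?thesis using skew[of "y i" "y j"] by (simp add: T_def mult.commute)
      qed (simp_all add: T_def alt)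
    qed
    also have "\<dots> = B a b - (\<Sum>i<r. \<Sum>j<r. T b a j i)"
      by (simp add: B_def sum_subtractf)
    also have "(\<Sum>i<r. \<Sum>j<r. T b a j i) = B b a"
      unfolding B_def by (rule sum.swap)
    finally show ?thesis .
  qed
  ultimately show ?thesis by blast
qed

lemma (in module) homogeneous_SW_le_of_flat:
  assumes bil: "bilinear_form scale \<Phi>" and alt: "\<forall>x. \<Phi> x x = 0" and flat: "flat_module scale"
    and f: "f \<in> fspan {delta w | w. length w = n}" "f \<in> SW_le scale \<Phi> n"
  shows "f \<in> sym_ideal scale {n}"
proof -
  obtain p g where fpg: "f = p + g" and p: "p \<in> weyl_ideal scale \<Phi>"
    and g: "g \<in> fspan {delta w | w. length w < n}"
    using f(2) unfolding SW_le_decomp by auto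
  have fin: "finsupp f" "finsupp g"
    using f(1) g by (auto elim!: finsupp_span)
  obtain X C where XC: "finite X" "finite C" "finsupp p"
    "\<And>h s. local_section scale X C h s \<Longrightarrow> wmap s p \<in> weyl_ideal fscale (\<lambda>a b. \<Phi> (h a) (h b))"
    using weyl_ideal_lifts[OF p] by blast
  obtain Y where Y: "finite Y"
    "\<And>h (s :: 'b \<Rightarrow> nat \<Rightarrow> 'a). (\<forall>x\<in>Y. h (s x) = x) \<Longrightarrow> wmap h (wmap s f) = f"
    using wmap_section[OF fin(1)] by blast
  \<comment> \<open>\<open>X\<close> and \<open>C\<close> serve to lift the relations in
    \<open>p\<close>; \<open>Y\<close> ensures that pushing forward along \<open>h\<close> recovers
    \<open>f\<close>.\<close>
  obtain r y s where sec: "local_section scale (X \<union> Y) C (lincomb scale r y) s"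
    using flat_local_section[OF flat, of "X \<union> Y" C] XC Y by auto
  define h where "h = lincomb scale r y"
  obtain B where B: "bilinear_form fscale B" "\<And>a b. \<Phi> (h a) (h b) = B a b - B b a"
    using alternating_pullback_difference_form[OF bil alt] unfolding h_def by blast
  have "wmap s p \<in> weyl_ideal fscale (\<lambda>a b. \<Phi> (h a) (h b))"
    unfolding h_def by (rule XC(4), rule local_section_mono[OF sec]) auto
  moreover have "wmap s g \<in> fspan {delta w | w. length w < n}"
    using g by (rule wmap_in_span_words[where P = "\<lambda>l. l < n"])
  moreover have "wmap s f = wmap s p + wmap s g" using fpg XC(3) fin by simp
  ultimately have "wmap s f \<in> SW_le fscale (\<lambda>a b. \<Phi> (h a) (h b)) n"
    unfolding SW_le_decomp by blast
  moreover have "wmap s f \<in> fspan {delta w | w. length w = n}"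
    using f(1) by (rule wmap_in_span_words[where P = "\<lambda>l. l = n"])
  ultimately have "wmap s f \<in> sym_ideal fscale {n}"
    by (intro homogeneous_SW_le_of_difference_form[OF B])
  then have "wmap h (wmap s f) \<in> sym_ideal scale {n}"
    by (rule wmap_sym_ideal[rotated 2]) (simp_all add: h_def lincomb_add lincomb_scale)
  moreover have "wmap h (wmap s f) = f"
    using sec by (intro Y(2)) (auto simp: local_section_def h_def)
  ultimately show ?thesis by simp
qed

section \<open>The canonical map\<close>

lemma coset_eq_iff:
  assumes "fun_module.subspace S"
  shows "coset S f = coset S g \<longleftrightarrow> f - g \<in> S"
proof
  assume "coset S f = coset S g"
  moreover have "f \<in> coset S f"
    unfolding coset_def using fun_module.subspace_0[OF assms] by (intro image_eqI[of _ _ 0]) auto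
  ultimately obtain s where "s \<in> S" "f = g + s" by (auto simp: coset_def)
  then show "f - g \<in> S" by simp
next
  assume d: "f - g \<in> S"
  have "f + s = g + ((f - g) + s)" "g + s = f + (s - (f - g))" for s by simp_all
  then show "coset S f = coset S g"
    unfolding coset_def using d fun_module.subspace_add[OF assms] fun_module.subspace_diff[OF assms]
    by (metis (no_types, lifting) image_iff set_eqI)
qed

text \<open>The canonical map is well defined: the union in \<open>phi_n\<close> runs over copies of
  one and the same coset.\<close>

lemma UN_coset:
  assumes "fun_module.subspace J" "fun_module.subspace S" "J \<subseteq> S"
  shows "(\<Union>f\<in>coset J g. coset S f) = coset S g"
proof -
  have "coset S f = coset S g" if "f \<in> coset J g" for f
    using that assms by (subst coset_eq_iff) (auto simp: coset_def)
  moreover have "g \<in> coset J g"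
    unfolding coset_def using fun_module.subspace_0[OF assms(1)] by (intro image_eqI[of _ _ 0]) auto
  ultimately show ?thesis by blast
qed

lemma subspace_SW_le: "fun_module.subspace (SW_le smul \<Phi> n)"
  by (simp add: SW_le_def)

text \<open>A commutator of length \<open>n\<close> differs from a Weyl relation by a multiple of a
  word of length \<open>n - 2\<close>.\<close>

lemma sym_ideal_subset_SW_le: "sym_ideal smul {n} \<subseteq> SW_le smul \<Phi> n"
  unfolding sym_ideal_def
proof (rule fun_module.span_minimal[OF _ subspace_SW_le], rule subsetI)
  fix t assume "t \<in> mult_rels smul {n} \<union> sym_rels {n}"
  then show "t \<in> SW_le smul \<Phi> n"
  proof
    assume "t \<in> mult_rels smul {n}"
    then have "t \<in> mult_rels smul UNIV" unfolding mult_rels_def by blast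
    then show ?thesis
      by (auto simp: SW_le_def weyl_ideal_def intro!: fun_module.span_base)
  next
    assume "t \<in> sym_rels {n}"
    then obtain u x y v where t: "t = delta (u @ [x, y] @ v) - delta (u @ [y, x] @ v)"
      and n: "length u + length v + 2 \<in> {n}" by (rule sym_relsE)
    let ?p = "delta (u @ [x, y] @ v) - delta (u @ [y, x] @ v) - fscale (\<Phi> x y) (delta (u @ v))"
    have "?p \<in> weyl_ideal smul \<Phi>"
      unfolding weyl_ideal_def by (intro fun_module.span_base UnI2 weyl_relsI)
    moreover have "fscale (\<Phi> x y) (delta (u @ v)) \<in> fspan {delta w | w. length w < n}"
      using n by (intro fun_module.span_scale fun_module.span_base) auto
    moreover have "t = ?p + fscale (\<Phi> x y) (delta (u @ v))" by (simp add: t)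
    ultimately show ?thesis unfolding SW_le_decomp by blast
  qed
qed

lemma SW_le_Suc:
  fixes smul :: "'k::comm_ring_1 \<Rightarrow> 'm::ab_group_add \<Rightarrow> 'm"
  assumes "f \<in> SW_le smul \<Phi> (Suc n)"
  obtains g where "g \<in> fspan {delta w | w. length w = n}" "f - g \<in> SW_le smul \<Phi> n"
proof -
  have "{delta w | w. length w < Suc n} =
      ({delta w | w. length w < n} \<union> {delta w | w. length w = n} :: ('m list \<Rightarrow> 'k) set)"
    by (auto simp: less_Suc_eq)
  then have "SW_le smul \<Phi> (Suc n)
      = fspan ((weyl_ideal smul \<Phi> \<union> {delta w | w. length w < n}) \<union> {delta w | w. length w = n})"
    by (simp add: SW_le_def Un_assoc)
  with assms obtain p g where "f = p + g" "p \<in> SW_le smul \<Phi> n" "g \<in> fspan {delta w | w. length w = n}"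
    unfolding SW_le_def[of smul \<Phi> n] fun_module.span_Un[of _ "{delta w | w. length w = n}"] by blast
  then show ?thesis by (intro that[of g]) auto
qed

theorem mainTheorem10:
  fixes smul :: "'k::comm_ring_1 \<Rightarrow> 'm::ab_group_add \<Rightarrow> 'm"
    and \<Phi> :: "'m \<Rightarrow> 'm \<Rightarrow> 'k"
  assumes "module smul"
    and "bilinear_form smul \<Phi>"
    and "\<forall>x. \<Phi> x x = 0"
    and "flat_module smul"
  shows "\<forall>n. bij_betw (phi_n smul \<Phi> n) (Sym_pow smul n) (gr_SW smul \<Phi> n)"
proof
  fix n
  let ?W = "fspan {delta w | w :: 'm list. length w = n} :: ('m list \<Rightarrow> 'k) set"
  let ?J = "sym_ideal smul {n}" and ?S = "SW_le smul \<Phi> n"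
  have Sym: "Sym_pow smul n = coset ?J ` ?W"
    by (simp add: Sym_pow_def quot_set_def sym_ideal_def)
  have phi: "phi_n smul \<Phi> n (coset ?J f) = coset ?S f" for f
    unfolding phi_n_def by (rule UN_coset[OF subspace_sym_ideal subspace_SW_le sym_ideal_subset_SW_le])
  have "inj_on (phi_n smul \<Phi> n) (Sym_pow smul n)"
  proof (rule inj_onI)
    fix P Q assume "P \<in> Sym_pow smul n" "Q \<in> Sym_pow smul n"
      and eq: "phi_n smul \<Phi> n P = phi_n smul \<Phi> n Q"
    then obtain f g where P: "P = coset ?J f" and Q: "Q = coset ?J g" and fg: "f \<in> ?W" "g \<in> ?W"
      unfolding Sym by blast
    \<comment> \<open>Injectivity reduces to the kernel: \<open>f - g\<close> is homogeneous of
      degree \<open>n\<close> and vanishes in the graded quotient.\<close>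
    have "f - g \<in> ?S" using eq unfolding P Q phi coset_eq_iff[OF subspace_SW_le] .
    moreover have "f - g \<in> ?W" using fg by (rule fun_module.span_diff)
    ultimately have "f - g \<in> ?J"
      by (intro module.homogeneous_SW_le_of_flat[OF assms])
    then show "P = Q" unfolding P Q coset_eq_iff[OF subspace_sym_ideal] .
  qed
  moreover have "phi_n smul \<Phi> n ` Sym_pow smul n = gr_SW smul \<Phi> n"
  proof -
    have "?W \<subseteq> SW_le smul \<Phi> (Suc n)"
      unfolding SW_le_def by (intro fun_module.span_mono) auto
    \<comment> \<open>Surjectivity: modulo shorter words and the Weyl ideal, each class has a
      homogeneous representative.\<close>
    moreover have "\<exists>g\<in>?W. coset ?S f = coset ?S g" if "f \<in> SW_le smul \<Phi> (Suc n)" for f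
    proof -
      from SW_le_Suc[OF that] obtain g where "g \<in> ?W" "f - g \<in> ?S" by blast
      then show ?thesis by (auto simp: coset_eq_iff[OF subspace_SW_le])
    qed
    ultimately have "coset ?S ` ?W = coset ?S ` SW_le smul \<Phi> (Suc n)"
      by (intro equalityI image_subsetI) (auto simp: image_iff)
    then show ?thesis by (simp add: Sym gr_SW_def quot_set_def image_image phi)
  qed
  ultimately show "bij_betw (phi_n smul \<Phi> n) (Sym_pow smul n) (gr_SW smul \<Phi> n)"
    by (simp add: bij_betw_def)
qed

end
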